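(* Let $n\ge1$, let $V:\mathbf{T}^n\to\mathbf{R}$ be $C^r$ for some $r>2n+2$, let $|\cdot|^2$ be a flat Riemannian metric on $\mathbf{T}^n=\mathbf{R}^n/\mathbf{Z}^n$, and let $H:T^*\mathbf{T}^n\to\mathbf{R}$ be the mechanical Hamiltonian $$H(q,p)=\tfrac12|p|^2+V(q).$$ Fix the thermostat mass $M>0$. Then the rescaled Nosé-thermostated Hamiltonian associated to $H$, $$F_\beta(\sigma,w,\Sigma,W)=\tfrac12|W/\sigma|^2+\tfrac12\Sigma^2+\beta V(\sqrt M\,w)+\ln\sigma,\qquad \beta=1/T,$$ is both Kolmogorov and iso-energetically non-degenerate in the $T=\infty$ limit; that is, the limiting Hamiltonian $F_0=\tfrac12|W/\sigma|^2+\tfrac12\Sigma^2+\ln\sigma$ is both Kolmogorov and iso-energetically non-degenerate on an open neighbourhood of its set of thermostatic equilibria.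
   Context: Here $\mathbf{R}^+=(0,\infty)$ and norms of covectors are taken with respect to the dual of the metric. The Nosé-thermostated Hamiltonian of $H$ is $F(s,q,p_s,p)=H(q,p\,s^{-1})+\frac1{2M}p_s^2+T\ln s$ on $T^*(\mathbf{R}^+\times\mathbf{T}^n)$, where the product $nkT$ ($n$ the number of degrees of freedom, $k$ Boltzmann's constant, $T$ the temperature) has been amalgamated into the single parameter denoted $T$. The canonical rescaling $q=\sqrt M\,w \bmod \mathbf{Z}^n$, $p=W/\sqrt M$, $s=\sigma/\sqrt{MT}$, $p_s=\sqrt{MT}\,\Sigma$ gives $F=T\,F_\beta-\frac12T\ln(MT)$, with $(\sigma,\Sigma)$ and $(w,W)$ canonically conjugate, $\sigma>0$, and $w$ in the torus $\mathbf{R}^n/(M^{-1/2}\mathbf{Z}^n)$. The set of thermostatic equilibria of $F_0$ is the set of points where $\dot\sigma=0=\dot\Sigma$ along its Hamiltonian flow, i.e. $\{\Sigma=0,\ |W|=\sigma\}$. Non-degeneracy. For a completely integrable Hamiltonian written as a function $h(I)$ of action variables $I=(I_1,\dots,I_m)$, with frequency vector $\omega=[\partial h/\partial I_i]$ and $d\omega=[\partial^2h/\partial I_i\partial I_j]$, $h$ is Kolmogorov non-degenerate at $I=C$ if $\det d\omega|_{I=C}\ne0$, and iso-energetically non-degenerate at $I=C$ if $$\det\begin{bmatrix}d\omega&\omega\\ \omega^{\top}&0\end{bmatrix}_{I=C}\neq0 .$$ A Hamiltonian is non-degenerate (in either sense) on a set of phase space if it is so at the action values of every point of that set. Action variables for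 $F_0$. $F_0$ does not depend on $w$ (in coordinates where the metric has constant coefficients), and on $\{W\neq0\}$, for each fixed $W$, it is a one-degree-of-freedom Hamiltonian in $(\sigma,\Sigma)$ with closed level curves surrounding a unique minimum, which is a thermostatic equilibrium. The $m=n+1$ action variables are $W_1,\dots,W_n$ and $A=\frac1{2\pi}\oint\Sigma\,d\sigma\ge0$ (the integral over the level curve through the point; both non-degeneracy conditions are unaffected by linear changes of the actions). The thermostatic equilibria correspond to $A=0$; there the derivatives of $F_0=h(A,W)$ are understood as those of its smooth extension up to $A=0$. *)

theory Defs
  imports "HOL-Analysis.Analysis"
begin

text \<open>
  \<open>Ck_holder k \<alpha> X f\<close>: on the open set \<open>X\<close>, \<open>f\<close> is of class \<open>C\<^sup>k\<close> and, if \<open>\<alpha> > 0\<close>, its partial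
  derivatives of order \<open>k\<close> are locally Hoelder continuous with exponent \<open>\<alpha>\<close>.
\<close>

primrec Ck_holder ::
  "nat \<Rightarrow> real \<Rightarrow> 'a::euclidean_space set \<Rightarrow> ('a \<Rightarrow> 'b::real_normed_vector) \<Rightarrow> bool" where
  "Ck_holder 0 \<alpha> X f \<longleftrightarrow> continuous_on X f \<and>
     (\<alpha> > 0 \<longrightarrow> (\<forall>x\<in>X. \<exists>e>0. \<exists>L. \<forall>y\<in>X \<inter> ball x e. \<forall>z\<in>X \<inter> ball x e.
                   norm (f y - f z) \<le> L * dist y z powr \<alpha>))"
| "Ck_holder (Suc k) \<alpha> X f \<longleftrightarrow> (\<forall>x\<in>X. f differentiable (at x)) \<and>
     (\<forall>b\<in>Basis. Ck_holder k \<alpha> X (\<lambda>x. frechet_derivative f (at x) b))"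

text \<open>Class \<open>C\<^sup>r\<close> for a real exponent \<open>r \<ge> 0\<close>; for integer \<open>r\<close> this is the usual class.\<close>

definition C_real :: "real \<Rightarrow> 'a::euclidean_space set \<Rightarrow> ('a \<Rightarrow> 'b::real_normed_vector) \<Rightarrow> bool" where
  "C_real r X f \<longleftrightarrow> Ck_holder (nat \<lfloor>r\<rfloor>) (frac r) X f"

definition smooth :: "'a::euclidean_space set \<Rightarrow> ('a \<Rightarrow> 'b::real_normed_vector) \<Rightarrow> bool" where
  "smooth X f \<longleftrightarrow> (\<forall>k. Ck_holder k 0 X f)"

text \<open>
  Objects on the torus \<open>\<real>\<^sup>n / \<int>\<^sup>n\<close> are represented by their lifts to \<open>\<real>\<^sup>n\<close>.
\<close>

definition int_lattice :: "(real^'n) set" where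
  "int_lattice = {k. \<forall>i. k $ i \<in> \<int>}"

definition torus_periodic :: "(real^'n \<Rightarrow> 'b) \<Rightarrow> bool" where
  "torus_periodic f \<longleftrightarrow> (\<forall>x. \<forall>k\<in>int_lattice. f (x + k) = f x)"

text \<open>\<open>g q\<close> is the matrix of the inner product on the tangent space at \<open>q\<close>.\<close>

definition riemannian_metric :: "(real^'n \<Rightarrow> real^'n^'n) \<Rightarrow> bool" where
  "riemannian_metric g \<longleftrightarrow> smooth UNIV g \<and> torus_periodic g \<and>
     (\<forall>q. transpose (g q) = g q \<and> (\<forall>v. v \<noteq> 0 \<longrightarrow> v \<bullet> (g q *v v) > 0))"

text \<open>A diffeomorphism of \<open>\<real>\<^sup>n\<close> that descends to a diffeomorphism of \<open>\<real>\<^sup>n / \<int>\<^sup>n\<close>.\<close>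

definition torus_diffeo :: "(real^'n \<Rightarrow> real^'n) \<Rightarrow> bool" where
  "torus_diffeo \<phi> \<longleftrightarrow> bij \<phi> \<and> smooth UNIV \<phi> \<and> smooth UNIV (inv \<phi>) \<and>
     (\<forall>x y. x - y \<in> int_lattice \<longleftrightarrow> \<phi> x - \<phi> y \<in> int_lattice)"

text \<open>In the coordinates \<open>\<phi>\<close> on the torus the metric has the constant coefficient matrix \<open>Q\<close>.\<close>

definition flat_coordinates ::
  "(real^'n \<Rightarrow> real^'n^'n) \<Rightarrow> (real^'n \<Rightarrow> real^'n) \<Rightarrow> real^'n^'n \<Rightarrow> bool" where
  "flat_coordinates g \<phi> Q \<longleftrightarrow> torus_diffeo \<phi> \<and>
     (\<forall>q. g q = transpose (jacobian \<phi> (at q)) ** Q ** jacobian \<phi> (at q))"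

definition flat_metric :: "(real^'n \<Rightarrow> real^'n^'n) \<Rightarrow> bool" where
  "flat_metric g \<longleftrightarrow> riemannian_metric g \<and> (\<exists>\<phi> Q. flat_coordinates g \<phi> Q)"

text \<open>The square of the dual norm of the covector \<open>p\<close> at \<open>q\<close>.\<close>

definition conorm2 :: "(real^'n \<Rightarrow> real^'n^'n) \<Rightarrow> real^'n \<Rightarrow> real^'n \<Rightarrow> real" where
  "conorm2 g q p = p \<bullet> (matrix_inv (g q) *v p)"

text \<open>
  Points of the cotangent bundle of \<open>\<real>\<^sup>+ \<times> \<real>\<^sup>n\<close> are written \<open>(s, q, p\<^sub>s, p)\<close>, or
  \<open>(\<sigma>, w, S, W)\<close> with \<open>S\<close> conjugate to \<open>\<sigma>\<close> and \<open>W\<close> conjugate to \<open>w\<close>.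
\<close>

type_synonym 'n phase = "real \<times> (real^'n) \<times> real \<times> (real^'n)"

definition phase_space :: "'n::finite phase set" where
  "phase_space = {(\<sigma>, w, S, W). \<sigma> > 0}"

definition mechanical ::
  "(real^'n \<Rightarrow> real^'n^'n) \<Rightarrow> (real^'n \<Rightarrow> real) \<Rightarrow> real^'n \<Rightarrow> real^'n \<Rightarrow> real" where
  "mechanical g V q p = conorm2 g q p / 2 + V q"

definition nose :: "real \<Rightarrow> real \<Rightarrow> (real^'n \<Rightarrow> real^'n \<Rightarrow> real) \<Rightarrow> 'n phase \<Rightarrow> real" where
  "nose M T H = (\<lambda>(s, q, ps, p). H q (p /\<^sub>R s) + ps\<^sup>2 / (2 * M) + T * ln s)"

definition nose_rescaled ::
  "(real^'n \<Rightarrow> real^'n^'n) \<Rightarrow> (real^'n \<Rightarrow> real) \<Rightarrow> real \<Rightarrow> real \<Rightarrow> 'n phase \<Rightarrow> real" where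
  "nose_rescaled g V M \<beta> = (\<lambda>(\<sigma>, w, S, W).
     conorm2 g (sqrt M *\<^sub>R w) (W /\<^sub>R \<sigma>) / 2 + S\<^sup>2 / 2 + \<beta> * V (sqrt M *\<^sub>R w) + ln \<sigma>)"

definition nose_limit :: "(real^'n \<Rightarrow> real^'n^'n) \<Rightarrow> real \<Rightarrow> 'n phase \<Rightarrow> real" where
  "nose_limit g M = (\<lambda>(\<sigma>, w, S, W).
     conorm2 g (sqrt M *\<^sub>R w) (W /\<^sub>R \<sigma>) / 2 + S\<^sup>2 / 2 + ln \<sigma>)"

lemma conorm2_scaleR: "conorm2 g q (c *\<^sub>R p) = c\<^sup>2 * conorm2 g q p"
  by (simp add: conorm2_def matrix_vector_mult_scaleR power2_eq_square)

lemma nose_rescaling: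
  fixes g :: "real^'n \<Rightarrow> real^'n^'n"
  assumes "M > 0" "T > 0" "\<sigma> > 0"
  shows "nose M T (mechanical g V)
           (\<sigma> / sqrt (M * T), sqrt M *\<^sub>R w, sqrt (M * T) * S, W /\<^sub>R sqrt M) =
         T * nose_rescaled g V M (1 / T) (\<sigma>, w, S, W) - T * ln (M * T) / 2"
proof -
  have "W /\<^sub>R sqrt M /\<^sub>R (\<sigma> / sqrt (M * T)) = sqrt T *\<^sub>R (W /\<^sub>R \<sigma>)"
    using assms by (simp add: real_sqrt_mult field_simps)
  hence "conorm2 g (sqrt M *\<^sub>R w) (W /\<^sub>R sqrt M /\<^sub>R (\<sigma> / sqrt (M * T))) =
         T * conorm2 g (sqrt M *\<^sub>R w) (W /\<^sub>R \<sigma>)"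
    using assms by (simp only: conorm2_scaleR) simp
  moreover have "T * ln (\<sigma> / sqrt (M * T)) = T * ln \<sigma> - T * ln (M * T) / 2"
    using assms by (simp add: ln_div ln_sqrt right_diff_distrib)
  moreover have "(sqrt (M * T) * S)\<^sup>2 / (2 * M) = T * (S\<^sup>2 / 2)"
    using assms by (simp add: power_mult_distrib)
  ultimately show ?thesis
    using assms by (simp add: nose_def mechanical_def nose_rescaled_def algebra_simps)
qed

text \<open>The points where \<open>\<sigma>' = \<partial>F/\<partial>S\<close> and \<open>S' = - \<partial>F/\<partial>\<sigma>\<close> vanish.\<close>

definition thermostatic_equilibria :: "('n::finite phase \<Rightarrow> real) \<Rightarrow> 'n phase set" where
  "thermostatic_equilibria F = {(\<sigma>, w, S, W). (\<sigma>, w, S, W) \<in> phase_space \<and>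
     deriv (\<lambda>y. F (\<sigma>, w, y, W)) S = 0 \<and> - deriv (\<lambda>x. F (x, w, S, W)) \<sigma> = 0}"

lemma thermostatic_equilibria_nose_limit:
  "thermostatic_equilibria (nose_limit g M) =
     {(\<sigma>, w, S, W). \<sigma> > 0 \<and> S = 0 \<and> conorm2 g (sqrt M *\<^sub>R w) W = \<sigma>\<^sup>2}"
proof -
  have 1: "deriv (\<lambda>y. nose_limit g M (\<sigma>, w, y, W)) S = S" for \<sigma> w S W
    unfolding nose_limit_def
    by (rule DERIV_imp_deriv) (auto intro!: derivative_eq_intros)
  have 2: "deriv (\<lambda>x. nose_limit g M (x, w, S, W)) \<sigma> =
             1 / \<sigma> - conorm2 g (sqrt M *\<^sub>R w) W / \<sigma> ^ 3" if "\<sigma> > 0" for \<sigma> w S W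
    unfolding nose_limit_def prod.case conorm2_scaleR
    by (rule DERIV_imp_deriv)
       (use that in \<open>auto intro!: derivative_eq_intros simp: field_simps power2_eq_square power3_eq_cube\<close>)
  show ?thesis
    unfolding thermostatic_equilibria_def phase_space_def
    by (auto simp: 1 2 field_simps power2_eq_square power3_eq_cube)
qed

text \<open>A subset of \<open>\<real>\<^sup>+ \<times> \<real>\<^sup>n \<times> \<real> \<times> \<real>\<^sup>n\<close> that is the lift of one in which \<open>w\<close> ranges over
  \<open>\<real>\<^sup>n / (M\<^sup>-\<^sup>1\<^sup>/\<^sup>2 \<int>\<^sup>n)\<close>.\<close>

definition torus_invariant :: "real \<Rightarrow> 'n::finite phase set \<Rightarrow> bool" where
  "torus_invariant M U \<longleftrightarrow>
     (\<forall>(\<sigma>, w, S, W)\<in>U. \<forall>k\<in>int_lattice. (\<sigma>, w + k /\<^sub>R sqrt M, S, W) \<in> U)"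

definition level_curve :: "('n::finite phase \<Rightarrow> real) \<Rightarrow> 'n phase \<Rightarrow> (real \<times> real) set" where
  "level_curve F = (\<lambda>(\<sigma>, w, S, W). {(x, y). x > 0 \<and> F (x, w, y, W) = F (\<sigma>, w, S, W)})"

text \<open>\<open>\<gamma>\<close> runs once around the closed curve \<open>L\<close>, which may degenerate to a point.\<close>

definition parametrizes :: "(real \<Rightarrow> real \<times> real) \<Rightarrow> (real \<times> real) set \<Rightarrow> bool" where
  "parametrizes \<gamma> L \<longleftrightarrow> valid_path \<gamma> \<and> pathfinish \<gamma> = pathstart \<gamma> \<and> path_image \<gamma> = L \<and>
     (simple_path \<gamma> \<or> (\<exists>z. L = {z}))"

definition line_integral_ydx :: "(real \<Rightarrow> real \<times> real) \<Rightarrow> real" where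
  "line_integral_ydx \<gamma> =
     integral {0..1} (\<lambda>t. snd (\<gamma> t) * fst (vector_derivative \<gamma> (at t within {0..1})))"

text \<open>The absolute value makes the action independent of the orientation of \<open>\<gamma>\<close>.\<close>

definition action :: "('n::finite phase \<Rightarrow> real) \<Rightarrow> 'n phase \<Rightarrow> real" where
  "action F x =
     (THE A. \<exists>\<gamma>. parametrizes \<gamma> (level_curve F x) \<and> A = \<bar>line_integral_ydx \<gamma>\<bar> / (2 * pi))"

text \<open>
  The momenta conjugate to the coordinates \<open>\<phi> (sqrt M *\<^sub>R w) /\<^sub>R sqrt M\<close>, in which the metric is
  constant.
\<close>

definition flat_momentum ::
  "(real^'n \<Rightarrow> real^'n) \<Rightarrow> real \<Rightarrow> real^'n \<Rightarrow> real^'n \<Rightarrow> real^'n" where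
  "flat_momentum \<phi> M w W = matrix_inv (transpose (jacobian \<phi> (at (sqrt M *\<^sub>R w)))) *v W"

text \<open>
  The vector of actions is indexed by \<open>'n option\<close>: component \<open>None\<close> is \<open>A\<close>, component \<open>Some i\<close> is
  the \<open>i\<close>-th flat momentum.
\<close>

definition actions ::
  "('n::finite phase \<Rightarrow> real) \<Rightarrow> (real^'n \<Rightarrow> real^'n) \<Rightarrow> real \<Rightarrow> 'n phase \<Rightarrow> real^('n option)" where
  "actions F \<phi> M = (\<lambda>(\<sigma>, w, S, W). \<chi> j. case j of
     None \<Rightarrow> action F (\<sigma>, w, S, W) | Some i \<Rightarrow> flat_momentum \<phi> M w W $ i)"

definition frequency :: "(real^'m \<Rightarrow> real) \<Rightarrow> real^'m \<Rightarrow> real^'m" where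
  "frequency h C = (\<chi> i. frechet_derivative h (at C) (axis i 1))"

definition d_frequency :: "(real^'m \<Rightarrow> real) \<Rightarrow> real^'m \<Rightarrow> real^'m^'m" where
  "d_frequency h C = jacobian (frequency h) (at C)"

definition bordered :: "real^'m^'m \<Rightarrow> real^'m \<Rightarrow> real^('m option)^('m option)" where
  "bordered D \<omega> = (\<chi> a b. case (a, b) of
     (Some i, Some j) \<Rightarrow> D $ i $ j | (Some i, None) \<Rightarrow> \<omega> $ i
   | (None, Some j) \<Rightarrow> \<omega> $ j | (None, None) \<Rightarrow> 0)"

definition kolmogorov_nondegenerate_at :: "(real^'m \<Rightarrow> real) \<Rightarrow> real^'m \<Rightarrow> bool" where
  "kolmogorov_nondegenerate_at h C \<longleftrightarrow> det (d_frequency h C) \<noteq> 0"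

definition isoenergetically_nondegenerate_at :: "(real^'m \<Rightarrow> real) \<Rightarrow> real^'m \<Rightarrow> bool" where
  "isoenergetically_nondegenerate_at h C \<longleftrightarrow> det (bordered (d_frequency h C) (frequency h C)) \<noteq> 0"

text \<open>
  \<open>F\<close>, on the region \<open>X\<close> of phase space, equals \<open>h (I x)\<close> wherever the actions \<open>I x\<close> lie in the
  open set \<open>N\<close>. As \<open>N\<close> is open and \<open>h\<close> smooth on it, \<open>h\<close> is a smooth extension across the boundary
  \<open>A = 0\<close> of the set of action values; its derivatives there are determined by continuity, so they do
  not depend on the extension.
\<close>

definition function_of_actions ::
  "('p \<Rightarrow> real) \<Rightarrow> 'p set \<Rightarrow> ('p \<Rightarrow> real^'m) \<Rightarrow> (real^'m \<Rightarrow> real) \<Rightarrow> (real^'m) set \<Rightarrow> bool" where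
  "function_of_actions F X I h N \<longleftrightarrow>
     open N \<and> smooth N h \<and> (\<forall>x\<in>X. I x \<in> N \<longrightarrow> F x = h (I x))"

definition nondegenerate_on ::
  "((real^'m \<Rightarrow> real) \<Rightarrow> real^'m \<Rightarrow> bool) \<Rightarrow>
   ('p \<Rightarrow> real) \<Rightarrow> 'p set \<Rightarrow> ('p \<Rightarrow> real^'m) \<Rightarrow> 'p set \<Rightarrow> bool" where
  "nondegenerate_on P F X I U \<longleftrightarrow> U \<subseteq> X \<and>
     (\<exists>h N. function_of_actions F X I h N \<and> (\<forall>x\<in>U. I x \<in> N \<and> P h (I x)))"

text \<open>The region where the action variables are defined.\<close>

definition nonzero_momentum :: "'n::finite phase set" where
  "nonzero_momentum = {(\<sigma>, w, S, W). (\<sigma>, w, S, W) \<in> phase_space \<and> W \<noteq> 0}"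

end

theory Submission
  imports Defs "HOL-Complex_Analysis.Complex_Analysis"
begin

text \<open>
  For fixed \<open>W \<noteq> 0\<close> put \<open>\<sigma> = |W| \<xi>\<close>. The limiting Hamiltonian becomes
  \<open>1/2 + ln |W| + e\<close>, where \<open>e = (1/(2\<xi>\<^sup>2) + ln \<xi> - 1/2) + \<Sigma>\<^sup>2/2\<close> does not contain \<open>W\<close> and is \<open>0\<close> exactly at the
  equilibria. The area enclosed by a level curve scales with \<open>|W|\<close>, so the action is \<open>A = |W| B(e)\<close> with
  a universal function \<open>B\<close>, and
  \<open>F\<^sub>0 = h(A, W) = 1/2 + ln |W| + \<beta>(A/|W|)\<close>, \<open>\<beta>\<close> being the inverse of \<open>B\<close>.

  Non-degeneracy. \<open>exp h\<close> is homogeneous of degree one. Hence at \<open>C = (A, W)\<close> Euler's relation gives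
  \<open>\<nabla>h \<bullet> C = 1\<close> and \<open>D\<^sup>2h C = - \<nabla>h\<close>. Both determinants are non-zero as soon as \<open>D\<^sup>2h v = - \<tau> \<nabla>h\<close> has the single
  solution \<open>v = \<tau> C\<close> (lemma \<open>bordered_kernel\<close>). That is so when \<open>1 - t \<beta>'(t)\<close> and \<open>\<beta>''(t) + \<beta>'(t)\<^sup>2\<close> do not
  vanish at \<open>t = A/|W|\<close>. In terms of \<open>B\<close> and the energy \<open>e\<close> the conditions read \<open>B \<noteq> B'\<close> and \<open>B' \<noteq> B''\<close>; they
  are open, and at \<open>e = 0\<close> they follow from \<open>B(0) = 0 < B'(0)\<close> and \<open>B''(0) = 11/12 B'(0)\<close>.

  Regularity of \<open>B\<close>. The potential in \<open>\<xi>\<close> has a non-degenerate minimum at \<open>\<xi> = 1\<close> and no other critical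
  point, so a Morse coordinate \<open>z\<close> exists on the whole half-line, and the level curves are the circles
  \<open>z\<^sup>2 + \<Sigma>\<^sup>2 = 2e\<close>. By the holomorphic inverse function theorem \<open>\<xi>\<close> is an analytic function of \<open>z\<close> near \<open>0\<close>.
  In the area integral over a circle only the even part of the integrand counts, so \<open>B\<close> is a power series in
  \<open>e\<close> near \<open>0\<close> (lemma \<open>unit_action_power_series\<close>), which continues it to negative \<open>e\<close>. Its first
  coefficients follow from the differential equation \<open>\<xi>' (\<xi>\<^sup>2 - 1) = z \<xi>\<^sup>3\<close>.

  Two global points need care. The action is well defined because every simple closed parametrization of a level curve
  winds around it exactly once (lemma \<open>line_integral_simple_loop\<close>). And \<open>h\<close>, which is constructed for small
  \<open>A/|W|\<close> only, must give the energy at every point with such actions; this holds since \<open>B\<close> is monotone on all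
  of \<open>[0, \<infinity>)\<close> (lemma \<open>unit_action_mono\<close>).
\<close>

section \<open>Smoothness from closure under partial derivatives\<close>

lemma frechet_derivative_cong_open:
  assumes "open N" "x \<in> N" "\<And>y. y \<in> N \<Longrightarrow> f y = g y" "(g has_derivative g') (at x)"
  shows "(f has_derivative g') (at x)" "frechet_derivative f (at x) = g'"
proof -
  show *: "(f has_derivative g') (at x)"
    by (rule has_derivative_transform_within_open[OF assms(4,1,2)]) (simp add: assms(3))
  show "frechet_derivative f (at x) = g'"
    using frechet_derivative_at[OF *] by simp
qed

text \<open>
  Smoothness is a statement about derivatives of all orders. A class of functions that contains the
  partial derivatives of its members can be differentiated without end, so it consists of smooth
  functions; the orders need never be handled one by one.
\<close>

lemma smooth_if_closed_under_partials:
  fixes \<F> :: "('a::euclidean_space \<Rightarrow> 'b::real_normed_vector) set"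
  assumes "open N"
    and closed: "\<And>f. f \<in> \<F> \<Longrightarrow> \<exists>f'. (\<forall>x\<in>N. (f has_derivative f' x) (at x)) \<and>
                                     (\<forall>b\<in>Basis. (\<lambda>x. f' x b) \<in> \<F>)"
    and "f \<in> \<F>"
  shows "smooth N f"
proof -
  \<comment> \<open>The derivative operator yields arbitrary values outside \<open>N\<close>, so the induction is over all
     functions \<open>h\<close> that agree on \<open>N\<close> with a member of the class.\<close>
  have "Ck_holder k 0 N h" if "f \<in> \<F>" "\<forall>x\<in>N. h x = f x" for k f h
    using that
  proof (induction k arbitrary: f h)
    case 0
    obtain f' where "\<forall>x\<in>N. (f has_derivative f' x) (at x)"
      using closed[OF 0(1)] by blast
    hence "\<forall>x\<in>N. (h has_derivative f' x) (at x)"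
      using frechet_derivative_cong_open(1)[OF \<open>open N\<close>] 0(2) by metis
    hence "continuous_on N h"
      by (meson continuous_at_imp_continuous_on has_derivative_continuous)
    thus ?case by simp
  next
    case (Suc k)
    obtain f' where f': "\<forall>x\<in>N. (f has_derivative f' x) (at x)"
      and cl: "\<forall>b\<in>Basis. (\<lambda>x. f' x b) \<in> \<F>"
      using closed[OF Suc(2)] by blast
    have h: "(h has_derivative f' x) (at x)" "frechet_derivative h (at x) = f' x" if "x \<in> N" for x
      using frechet_derivative_cong_open[OF \<open>open N\<close> that, of h f "f' x"] f' that Suc(3) by auto
    have "Ck_holder k 0 N (\<lambda>x. frechet_derivative h (at x) b)" if "b \<in> Basis" for b
      by (rule Suc.IH[of "\<lambda>x. f' x b"]) (use cl that h in auto)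
    thus ?case using h by (auto simp: differentiable_def)
  qed
  thus ?thesis using assms(3) by (auto simp: smooth_def)
qed

inductive_set function_algebra :: "('a \<Rightarrow> real) set \<Rightarrow> ('a \<Rightarrow> real) set" for G where
  gen: "f \<in> G \<Longrightarrow> f \<in> function_algebra G"
| const: "(\<lambda>_. c) \<in> function_algebra G"
| add: "f \<in> function_algebra G \<Longrightarrow> g \<in> function_algebra G \<Longrightarrow> (\<lambda>x. f x + g x) \<in> function_algebra G"
| mult: "f \<in> function_algebra G \<Longrightarrow> g \<in> function_algebra G \<Longrightarrow> (\<lambda>x. f x * g x) \<in> function_algebra G"

text \<open>
  By the sum and product rules it suffices to know the first partial derivatives of the generators.
\<close>

lemma smooth_function_algebra:
  fixes G :: "('a::euclidean_space \<Rightarrow> real) set"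
  assumes "open N"
    and G: "\<And>f. f \<in> G \<Longrightarrow> \<exists>f'. (\<forall>x\<in>N. (f has_derivative f' x) (at x)) \<and>
                                     (\<forall>b\<in>Basis. (\<lambda>x. f' x b) \<in> function_algebra G)"
    and "f \<in> function_algebra G"
  shows "smooth N f"
proof (rule smooth_if_closed_under_partials[OF \<open>open N\<close> _ \<open>f \<in> function_algebra G\<close>])
  fix f assume "f \<in> function_algebra G"
  thus "\<exists>f'. (\<forall>x\<in>N. (f has_derivative f' x) (at x)) \<and> (\<forall>b\<in>Basis. (\<lambda>x. f' x b) \<in> function_algebra G)"
  proof induction
    case (gen f)
    thus ?case by (rule G)
  next
    case (const c)
    show ?case by (intro exI[of _ "\<lambda>_ _. 0"]) (auto intro: function_algebra.const)
  next
    case (add f g)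
    then obtain f' g' where "\<forall>x\<in>N. (f has_derivative f' x) (at x)" "\<forall>b\<in>Basis. (\<lambda>x. f' x b) \<in> function_algebra G"
      "\<forall>x\<in>N. (g has_derivative g' x) (at x)" "\<forall>b\<in>Basis. (\<lambda>x. g' x b) \<in> function_algebra G" by blast
    thus ?case
      by (intro exI[of _ "\<lambda>x v. f' x v + g' x v"]) (auto intro!: has_derivative_add function_algebra.add)
  next
    case (mult f g)
    then obtain f' g' where "\<forall>x\<in>N. (f has_derivative f' x) (at x)" "\<forall>b\<in>Basis. (\<lambda>x. f' x b) \<in> function_algebra G"
      "\<forall>x\<in>N. (g has_derivative g' x) (at x)" "\<forall>b\<in>Basis. (\<lambda>x. g' x b) \<in> function_algebra G" by blast
    with mult(1,2) show ?case
      by (intro exI[of _ "\<lambda>x v. f x * g' x v + f' x v * g x"])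
         (auto intro!: has_derivative_mult function_algebra.add function_algebra.mult)
  qed
qed

section \<open>Line integrals over simple closed curves\<close>

text \<open>
  Differentiability passes from a composition to its inner function wherever the outer derivative does
  not vanish: by Caratheodory's criterion the increment of the outer function is a continuous factor times
  that of the inner one, and this factor can be divided out.
\<close>

lemma DERIV_inner_function:
  fixes F \<Theta> :: "real \<Rightarrow> real"
  assumes F: "(F has_real_derivative F') (at (\<Theta> t))" "F' \<noteq> 0" and "isCont \<Theta> t"
    and D: "((\<lambda>s. F (\<Theta> s)) has_real_derivative D) (at t)"
  shows "(\<Theta> has_real_derivative D / F') (at t)"
proof -
  obtain q where q: "\<And>z. F z - F (\<Theta> t) = q z * (z - \<Theta> t)" "isCont q (\<Theta> t)" "q (\<Theta> t) = F'"
    using F(1) by (auto simp: CARAT_DERIV)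
  have q_lim: "((\<lambda>s. q (\<Theta> s)) \<longlongrightarrow> F') (at t)"
    using isCont_o2[OF \<open>isCont \<Theta> t\<close> q(2)] q(3) by (simp add: isCont_def)
  have "((\<lambda>s. (F (\<Theta> s) - F (\<Theta> t)) / (s - t) / q (\<Theta> s)) \<longlongrightarrow> D / F') (at t)"
    using D F(2) q_lim by (intro tendsto_divide) (auto simp: has_field_derivative_iff)
  moreover have "\<forall>\<^sub>F s in at t. q (\<Theta> s) \<noteq> 0"
    using tendsto_imp_eventually_ne[OF q_lim F(2)] .
  hence "\<forall>\<^sub>F s in at t. (F (\<Theta> s) - F (\<Theta> t)) / (s - t) / q (\<Theta> s) = (\<Theta> s - \<Theta> t) / (s - t)"
    by eventually_elim (simp add: q(1))
  ultimately show ?thesis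
    by (auto simp: has_field_derivative_iff elim: Lim_transform_eventually)
qed

text \<open>
  A simple loop whose image is a homeomorphic copy of the unit circle is pulled back to a simple loop
  that runs over the unit circle. Its winding number about \<open>0\<close>, which counts the turns of the imaginary part of
  a continuous logarithm, is \<open>1\<close> or \<open>-1\<close>.
\<close>

lemma simple_loop_angle:
  fixes e :: "complex \<Rightarrow> 'a::real_normed_vector"
  assumes e: "continuous_on (sphere 0 1) e" "inj_on e (sphere 0 1)"
    and \<gamma>: "simple_path \<gamma>" "pathfinish \<gamma> = pathstart \<gamma>" "path_image \<gamma> = e ` sphere 0 1"
  obtains \<Theta> where "continuous_on {0..1} \<Theta>" "\<And>t. t \<in> {0..1} \<Longrightarrow> \<gamma> t = e (cis (\<Theta> t))"
    "\<Theta> 1 = \<Theta> 0 + 2 * pi \<or> \<Theta> 1 = \<Theta> 0 - 2 * pi"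
proof -
  define j where "j = the_inv_into (sphere 0 1) e"
  have j: "j (e z) = z" if "z \<in> sphere 0 1" for z
    using e(2) that by (simp add: j_def the_inv_into_f_f)
  have j_cont: "continuous_on (e ` sphere 0 1) j"
    using continuous_on_inv[OF e(1) compact_sphere] j by blast
  have j_inj: "inj_on j (e ` sphere 0 1)"
    using j by (auto simp: inj_on_def)
  define p where "p = j \<circ> \<gamma>"
  have p: "simple_path p"
    unfolding p_def using \<gamma> j_cont j_inj by (intro simple_path_continuous_image) auto
  have "path_image p = j ` e ` sphere 0 1"
    by (simp add: p_def path_image_compose \<gamma>)
  also have "\<dots> = sphere 0 1"
    using j by (force simp: image_iff)
  finally have im: "path_image p = sphere 0 1" .
  have "inside (sphere (0::complex) 1) = ball 0 1"
    using inside_frontier_eq_interior[of "cball (0::complex) 1"] by simp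
  hence "0 \<in> inside (path_image p)" by (simp add: im)
  moreover have "pathfinish p = pathstart p"
    using \<gamma>(2) by (simp add: p_def pathfinish_def pathstart_def)
  ultimately have w: "winding_number p 0 = 1 \<or> winding_number p 0 = -1"
    by (metis simple_closed_path_winding_number_inside[OF p])
  obtain q where q: "path q" "pathfinish q - pathstart q = 2 * of_real pi * \<i> * winding_number p 0"
    "\<And>t. t \<in> {0..1} \<Longrightarrow> p t = 0 + exp (q t)"
    using winding_number_as_continuous_log[of p 0] p im by (auto simp: simple_path_imp_path)
  have pt: "p t \<in> sphere 0 1" "\<gamma> t = e (p t)" if "t \<in> {0..1}" for t
  proof -
    show "p t \<in> sphere 0 1" using that im by (auto simp: path_image_def)
    have "\<gamma> t \<in> e ` sphere 0 1" using that \<gamma>(3) by (auto simp: path_image_def)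
    thus "\<gamma> t = e (p t)" using j by (auto simp: p_def)
  qed
  show ?thesis
  proof
    show "continuous_on {0..1} (\<lambda>t. Im (q t))"
      using q(1) by (auto simp: path_def intro: continuous_intros)
    show "\<gamma> t = e (cis (Im (q t)))" if "t \<in> {0..1}" for t
    proof -
      have "norm (p t) = 1" using pt(1)[OF that] by simp
      hence "exp (Re (q t)) = 1" using q(3)[OF that] by simp
      hence "p t = cis (Im (q t))" using q(3)[OF that] by (simp add: exp_eq_polar)
      thus ?thesis using pt(2)[OF that] by simp
    qed
    have "Im (q 1) - Im (q 0) = Im (2 * of_real pi * \<i> * winding_number p 0)"
      using q(2) by (simp add: pathfinish_def pathstart_def flip: minus_complex.sel)
    thus "Im (q 1) = Im (q 0) + 2 * pi \<or> Im (q 1) = Im (q 0) - 2 * pi"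
      using w by auto
  qed
qed

lemma antiderivative_periodic_increment:
  fixes G \<omega> :: "real \<Rightarrow> real"
  assumes G: "\<And>\<theta>. (G has_real_derivative \<omega> \<theta>) (at \<theta>)" and per: "\<And>\<theta>. \<omega> (\<theta> + p) = \<omega> \<theta>"
  shows "G (\<theta> + p) - G \<theta> = G p - G 0"
proof -
  have "((\<lambda>\<theta>. G (\<theta> + p) - G \<theta>) has_real_derivative 0) (at \<theta>)" for \<theta>
    using DERIV_diff[OF DERIV_shift[THEN iffD1, OF G[of "\<theta> + p"]] G[of \<theta>]] by (simp add: per)
  hence "(\<lambda>\<theta>. G (\<theta> + p) - G \<theta>) \<theta> = (\<lambda>\<theta>. G (\<theta> + p) - G \<theta>) 0"
    using DERIV_isconst_all by blast
  thus ?thesis by simp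
qed

text \<open>
  The value of \<open>\<integral> y dx\<close> over a simple loop depends only on its image, up to sign. Along the continuous
  angle \<open>\<Theta>\<close> of the loop the integrand is the derivative of \<open>G \<circ> \<Theta>\<close>, where \<open>G\<close> is a primitive of the
  periodic function that represents \<open>y dx\<close> on the circle. As \<open>\<Theta>\<close> increases or decreases by exactly \<open>2\<pi>\<close>, the
  integral is plus or minus the increment of \<open>G\<close> over one period. The curve must be immersed so that \<open>\<Theta>\<close>
  is differentiable wherever the loop is.
\<close>

lemma line_integral_simple_loop:
  fixes e :: "complex \<Rightarrow> real \<times> real"
  assumes e: "continuous_on (sphere 0 1) e" "inj_on e (sphere 0 1)"
    and x': "\<And>\<theta>. ((\<lambda>\<theta>. fst (e (cis \<theta>))) has_real_derivative x' \<theta>) (at \<theta>)" "continuous_on UNIV x'"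
    and y': "\<And>\<theta>. ((\<lambda>\<theta>. snd (e (cis \<theta>))) has_real_derivative y' \<theta>) (at \<theta>)"
    and immersed: "\<And>\<theta>. x' \<theta> \<noteq> 0 \<or> y' \<theta> \<noteq> 0"
    and \<gamma>: "valid_path \<gamma>" "simple_path \<gamma>" "pathfinish \<gamma> = pathstart \<gamma>" "path_image \<gamma> = e ` sphere 0 1"
  shows "\<bar>line_integral_ydx \<gamma>\<bar> = \<bar>integral {0..2 * pi} (\<lambda>\<theta>. snd (e (cis \<theta>)) * x' \<theta>)\<bar>"
proof -
  define \<omega> where "\<omega> \<theta> = snd (e (cis \<theta>)) * x' \<theta>" for \<theta>
  have y_cont: "continuous_on UNIV (\<lambda>\<theta>. snd (e (cis \<theta>)))"
    using y' by (meson DERIV_isCont continuous_at_imp_continuous_on)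
  have per: "\<omega> (\<theta> + 2 * pi) = \<omega> \<theta>" for \<theta>
  proof -
    have [simp]: "cis (\<theta> + 2 * pi) = cis \<theta>" for \<theta> by (simp flip: cis_mult)
    have "x' (\<theta> + 2 * pi) = x' \<theta>"
      using DERIV_shift[THEN iffD1, OF x'(1)[of "\<theta> + 2 * pi"]] x'(1)[of \<theta>]
      by (auto dest: DERIV_unique)
    thus ?thesis by (simp add: \<omega>_def)
  qed
  have "continuous_on UNIV \<omega>"
    unfolding \<omega>_def by (intro continuous_intros y_cont x')
  hence "\<exists>G. \<forall>x::real. -\<infinity> < ereal x \<longrightarrow> ereal x < \<infinity> \<longrightarrow> (G has_vector_derivative \<omega> x) (at x)"
    by (intro einterval_antiderivative) (auto simp: continuous_on_eq_continuous_at)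
  then obtain G where G: "\<And>\<theta>. (G has_real_derivative \<omega> \<theta>) (at \<theta>)"
    by (auto simp: has_real_derivative_iff_has_vector_derivative)
  obtain \<Theta> where \<Theta>: "continuous_on {0..1} \<Theta>" "\<And>t. t \<in> {0..1} \<Longrightarrow> \<gamma> t = e (cis (\<Theta> t))"
    "\<Theta> 1 = \<Theta> 0 + 2 * pi \<or> \<Theta> 1 = \<Theta> 0 - 2 * pi"
    using simple_loop_angle[OF e \<gamma>(2-4)] by blast
  obtain S \<gamma>' where S: "finite S" and \<gamma>': "\<And>t. t \<in> {0..1} - S \<Longrightarrow> (\<gamma> has_vector_derivative \<gamma>' t) (at t)"
    using \<gamma>(1) unfolding valid_path_def piecewise_C1_differentiable_on_def C1_differentiable_on_def
    by metis
  define f where "f t = snd (\<gamma> t) * fst (vector_derivative \<gamma> (at t within {0..1}))" for t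
  have deriv: "((\<lambda>t. G (\<Theta> t)) has_vector_derivative f t) (at t)" if t: "t \<in> {0<..<1} - S" for t
  proof -
    have t01: "t \<in> {0..1}" "t \<notin> S" "t \<in> {0<..<1}" using t by auto
    have vd: "vector_derivative \<gamma> (at t within {0..1}) = \<gamma>' t"
      using \<gamma>'[of t] t01 by (auto intro!: vector_derivative_at_within_ivl)
    have near: "\<forall>\<^sub>F s in nhds t. e (cis (\<Theta> s)) = \<gamma> s"
      using eventually_nhds_in_open[of "{0<..<1}" t] t01(3) \<Theta>(2)
      by (auto elim!: eventually_mono)
    have "(\<gamma> has_derivative (\<lambda>h. h *\<^sub>R \<gamma>' t)) (at t)"
      using \<gamma>'[of t] t01 by (simp add: has_vector_derivative_def)
    from has_derivative_fst[OF this] has_derivative_snd[OF this]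
    have "((\<lambda>s. fst (\<gamma> s)) has_real_derivative fst (\<gamma>' t)) (at t)"
         "((\<lambda>s. snd (\<gamma> s)) has_real_derivative snd (\<gamma>' t)) (at t)"
      by (simp_all add: has_field_derivative_def mult.commute[of _ "_ (\<gamma>' t)"])
    moreover have "\<forall>\<^sub>F s in nhds t. fst (e (cis (\<Theta> s))) = fst (\<gamma> s)"
       "\<forall>\<^sub>F s in nhds t. snd (e (cis (\<Theta> s))) = snd (\<gamma> s)"
      using near by (auto elim: eventually_mono)
    ultimately have comp: "((\<lambda>s. fst (e (cis (\<Theta> s)))) has_real_derivative fst (\<gamma>' t)) (at t)"
         and comp': "((\<lambda>s. snd (e (cis (\<Theta> s)))) has_real_derivative snd (\<gamma>' t)) (at t)"
      by (simp_all only: DERIV_cong_ev[OF refl _ refl])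
    have \<Theta>_cont: "isCont \<Theta> t"
      using \<Theta>(1) t01(3) continuous_on_interior[of "{0..1}" \<Theta> t] by simp
    have "\<exists>D. (\<Theta> has_real_derivative D) (at t)"
      using immersed[of "\<Theta> t"]
        DERIV_inner_function[OF x'(1) _ \<Theta>_cont comp] DERIV_inner_function[OF y' _ \<Theta>_cont comp']
      by blast
    then obtain D where D: "(\<Theta> has_real_derivative D) (at t)" ..
    have "fst (\<gamma>' t) = x' (\<Theta> t) * D"
      using DERIV_unique[OF comp DERIV_chain2[OF x'(1) D]] .
    hence "f t = \<omega> (\<Theta> t) * D"
      using \<Theta>(2)[OF t01(1)] by (simp add: f_def vd \<omega>_def)
    thus ?thesis
      using DERIV_chain2[OF G D] by (simp add: has_real_derivative_iff_has_vector_derivative)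
  qed
  have "continuous_on {0..1} (\<lambda>t. G (\<Theta> t))"
    using G \<Theta>(1) by (intro continuous_on_compose2[of UNIV G _ \<Theta>])
      (auto intro!: continuous_at_imp_continuous_on dest: DERIV_isCont)
  hence "(f has_integral (G (\<Theta> 1) - G (\<Theta> 0))) {0..1}"
    using deriv by (intro fundamental_theorem_of_calculus_interior_strong[OF S]) auto
  hence "line_integral_ydx \<gamma> = G (\<Theta> 1) - G (\<Theta> 0)"
    by (auto simp: line_integral_ydx_def f_def[abs_def] integral_unique)
  moreover have "(\<omega> has_integral (G (2 * pi) - G 0)) {0..2 * pi}"
    using G by (intro fundamental_theorem_of_calculus)
      (auto simp: has_real_derivative_iff_has_vector_derivative intro: has_vector_derivative_at_within)
  hence "integral {0..2 * pi} \<omega> = G (2 * pi) - G 0"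
    by (rule integral_unique)
  ultimately show ?thesis
    using \<Theta>(3) antiderivative_periodic_increment[of G \<omega> "2 * pi" "\<Theta> 0", OF G per]
      antiderivative_periodic_increment[of G \<omega> "2 * pi" "\<Theta> 1", OF G per]
    by (auto simp: \<omega>_def[abs_def])
qed

text \<open>
  The angle itself is an admissible parameter of the curve, so an action is defined at all.
\<close>

lemma parametrizes_circle_image:
  fixes e :: "complex \<Rightarrow> real \<times> real"
  assumes inj: "inj_on e (sphere 0 1)"
    and x': "\<And>\<theta>. ((\<lambda>\<theta>. fst (e (cis \<theta>))) has_real_derivative x' \<theta>) (at \<theta>)" "continuous_on UNIV x'"
    and y': "\<And>\<theta>. ((\<lambda>\<theta>. snd (e (cis \<theta>))) has_real_derivative y' \<theta>) (at \<theta>)" "continuous_on UNIV y'"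
  shows "parametrizes (\<lambda>t. e (cis (2 * pi * t))) (e ` sphere 0 1)"
proof -
  let ?\<gamma> = "\<lambda>t. e (cis (2 * pi * t))"
  have deriv: "(?\<gamma> has_vector_derivative (x' (2 * pi * t) * (2 * pi), y' (2 * pi * t) * (2 * pi))) (at t)" for t
  proof -
    have "((\<lambda>t. 2 * pi * t) has_real_derivative 2 * pi) (at t)"
      by (auto intro!: derivative_eq_intros)
    from DERIV_chain2[OF x'(1) this] DERIV_chain2[OF y'(1) this]
    have "((\<lambda>t. (fst (?\<gamma> t), snd (?\<gamma> t))) has_vector_derivative
            (x' (2 * pi * t) * (2 * pi), y' (2 * pi * t) * (2 * pi))) (at t)"
      by (intro has_vector_derivative_Pair) (simp_all add: has_real_derivative_iff_has_vector_derivative)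
    thus ?thesis by simp
  qed
  have "continuous_on A (\<lambda>t. (x' (2 * pi * t) * (2 * pi), y' (2 * pi * t) * (2 * pi)))" for A
    by (intro continuous_intros continuous_on_compose2[OF x'(2)] continuous_on_compose2[OF y'(2)]) auto
  hence "?\<gamma> C1_differentiable_on {0..1}"
    unfolding C1_differentiable_on_def
    by (intro exI[of _ "\<lambda>t. (x' (2 * pi * t) * (2 * pi), y' (2 * pi * t) * (2 * pi))"] conjI ballI deriv)
  hence valid: "valid_path ?\<gamma>"
    by (simp add: valid_path_def C1_differentiable_imp_piecewise)
  have cis_eq: "s = t \<or> s = 0 \<and> t = 1 \<or> s = 1 \<and> t = 0"
    if eq: "cis (2 * pi * s) = cis (2 * pi * t)" and st: "s \<in> {0..1}" "t \<in> {0..1}" for s t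
  proof -
    obtain n :: int where "2 * pi * s = 2 * pi * t + 2 * pi * n"
      using sin_cos_eq_iff[of "2 * pi * s" "2 * pi * t"] arg_cong[OF eq, of Re] arg_cong[OF eq, of Im]
      by auto
    hence "pi * s = pi * (t + n)" by (simp add: algebra_simps)
    hence n: "s = t + n" by simp
    hence "\<bar>real_of_int n\<bar> \<le> 1" using st by auto
    hence "n = -1 \<or> n = 0 \<or> n = 1" by linarith
    thus ?thesis using n st by auto
  qed
  have "simple_path ?\<gamma>"
    unfolding simple_path_def loop_free_def
  proof (intro conjI ballI impI)
    show "path ?\<gamma>" using valid by (rule valid_path_imp_path)
    fix s t :: real assume st: "s \<in> {0..1}" "t \<in> {0..1}" "?\<gamma> s = ?\<gamma> t"
    hence "cis (2 * pi * s) = cis (2 * pi * t)" using inj by (auto simp: inj_on_def)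
    thus "s = t \<or> s = 0 \<and> t = 1 \<or> s = 1 \<and> t = 0" using cis_eq st by blast
  qed
  moreover have "path_image ?\<gamma> = e ` sphere 0 1"
  proof -
    have "z \<in> (\<lambda>t. cis (2 * pi * t)) ` {0..1}" if "norm z = 1" for z
    proof -
      have "Re z ^ 2 + Im z ^ 2 = 1" using that by (simp add: cmod_def)
      then obtain t where "0 \<le> t" "t < 2 * pi" "Re z = cos t" "Im z = sin t"
        using sincos_total_2pi by metis
      hence "z = cis (2 * pi * (t / (2 * pi)))" "t / (2 * pi) \<in> {0..1}" by (auto simp: complex_eq_iff)
      thus ?thesis by blast
    qed
    hence "(\<lambda>t. cis (2 * pi * t)) ` {0..1} = sphere 0 1" by auto
    moreover have "path_image ?\<gamma> = e ` (\<lambda>t. cis (2 * pi * t)) ` {0..1}"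
      by (simp add: path_image_def image_image)
    ultimately show ?thesis by simp
  qed
  ultimately show ?thesis
    using valid by (simp add: parametrizes_def pathfinish_def pathstart_def)
qed

section \<open>The Morse coordinate of the thermostat potential\<close>

text \<open>
  On a fixed \<open>W\<close> of norm \<open>1\<close> the potential in \<open>\<sigma>\<close> is \<open>1/(2\<sigma>\<^sup>2) + ln \<sigma>\<close>. With \<open>\<sigma> = exp (s/2)\<close> it becomes
  \<open>(1 + toda s)/2\<close>, where \<open>toda\<close> is the potential of the two-particle Toda lattice with its minimum moved
  to the origin.
\<close>

definition toda :: "real \<Rightarrow> real" where "toda s = exp (- s) + s - 1"

lemma toda_has_derivative: "(toda has_real_derivative 1 - exp (- s)) (at s)"
  unfolding toda_def by (auto intro!: derivative_eq_intros)

lemma toda_continuous: "continuous_on A toda"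
  unfolding toda_def by (intro continuous_intros)

lemma toda_0 [simp]: "toda 0 = 0"
  by (simp add: toda_def)

lemma toda_strict_mono: "0 \<le> s \<Longrightarrow> s < t \<Longrightarrow> toda s < toda t"
  by (rule DERIV_pos_imp_increasing_open[OF _ _ toda_continuous])
     (auto intro!: exI toda_has_derivative)

lemma toda_strict_antimono: "t \<le> 0 \<Longrightarrow> s < t \<Longrightarrow> toda t < toda s"
  by (rule DERIV_neg_imp_decreasing_open[OF _ _ toda_continuous])
     (auto intro!: exI toda_has_derivative)

lemma toda_nonneg: "0 \<le> toda s"
  using toda_strict_mono[of 0 s] toda_strict_antimono[of 0 s] by (cases s "0::real" rule: linorder_cases) auto

lemma toda_pos: "s \<noteq> 0 \<Longrightarrow> 0 < toda s"
  using toda_strict_mono[of 0 s] toda_strict_antimono[of 0 s] by (cases s "0::real" rule: linorder_cases) auto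

text \<open>
  The coordinate in which \<open>toda\<close> is a square. It is used on the whole line: the actions of
  high-energy level curves have to be compared with those of low-energy ones.
\<close>

definition morse_coord :: "real \<Rightarrow> real" where
  "morse_coord s = (if s \<le> 0 then - sqrt (toda s) else sqrt (toda s))"

lemma morse_coord_square: "(morse_coord s)\<^sup>2 = toda s"
  by (simp add: morse_coord_def toda_nonneg)

lemma sgn_morse_coord: "sgn (morse_coord s) = sgn s"
  using toda_pos[of s] by (cases s "0::real" rule: linorder_cases) (auto simp: morse_coord_def)

lemma morse_coord_continuous: "isCont morse_coord s"
proof -
  have "continuous_on ({..0} \<union> {0..}) morse_coord"
    unfolding morse_coord_def
    by (rule continuous_on_If) (auto intro!: continuous_intros toda_continuous)
  moreover have "{..0} \<union> {0..} = (UNIV :: real set)" by auto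
  ultimately show ?thesis by (simp add: continuous_on_eq_continuous_at)
qed

lemma morse_coord_strict_mono: "s < t \<Longrightarrow> morse_coord s < morse_coord t"
proof -
  assume st: "s < t"
  consider "t \<le> 0" | "0 \<le> s" | "s < 0" "0 < t" by linarith
  thus ?thesis
  proof cases
    case 1
    thus ?thesis using st toda_strict_antimono[of t s] by (simp add: morse_coord_def)
  next
    case 2
    thus ?thesis using st toda_strict_mono[of s t] by (auto simp: morse_coord_def)
  next
    case 3
    thus ?thesis using toda_pos[of s] toda_pos[of t]
      by (simp add: morse_coord_def) (smt (verit) real_sqrt_gt_0_iff)
  qed
qed

lemma morse_coord_surj: "\<exists>s. morse_coord s = z"
proof -
  define u where "u = 2 * \<bar>z\<bar> + z\<^sup>2 + 1"
  have u: "u > 0" by (simp add: u_def add_nonneg_pos)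
  have "z\<^sup>2 \<le> toda u" by (simp add: toda_def u_def)
  hence *: "z \<le> morse_coord u"
    using u by (simp add: morse_coord_def real_le_rsqrt)
  have "(2 * \<bar>z\<bar>)\<^sup>2 \<le> u\<^sup>2"
    unfolding u_def by (intro power_mono) auto
  hence "z\<^sup>2 \<le> u\<^sup>2 / 2" by (simp add: power_mult_distrib) (smt (verit) zero_le_power2)
  also have "\<dots> \<le> toda (- u)"
    using exp_lower_Taylor_quadratic[of u] u by (simp add: toda_def)
  finally have "- z \<le> sqrt (toda (- u))" by (intro real_le_rsqrt) simp
  hence "morse_coord (- u) \<le> z" using u by (simp add: morse_coord_def)
  with * u IVT[of morse_coord "-u" z u] show ?thesis
    by (auto simp: morse_coord_continuous)
qed

definition morse_inv :: "real \<Rightarrow> real" where "morse_inv = inv morse_coord"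

lemma inj_morse_coord: "inj morse_coord"
  by (metis injI linorder_neqE_linordered_idom morse_coord_strict_mono order_less_irrefl)

lemma morse_inv_morse_coord [simp]: "morse_inv (morse_coord s) = s"
  by (simp add: morse_inv_def inj_morse_coord)

lemma morse_coord_morse_inv [simp]: "morse_coord (morse_inv z) = z"
  unfolding morse_inv_def by (metis f_inv_into_f morse_coord_surj rangeI)

lemma toda_morse_inv: "toda (morse_inv z) = z\<^sup>2"
  by (metis morse_coord_morse_inv morse_coord_square)

lemma sgn_morse_inv: "sgn (morse_inv z) = sgn z"
  by (metis morse_coord_morse_inv sgn_morse_coord)

lemma morse_inv_eqI: "toda s = z\<^sup>2 \<Longrightarrow> sgn s = sgn z \<Longrightarrow> morse_inv z = s"
proof -
  assume "toda s = z\<^sup>2" "sgn s = sgn z"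
  hence "(morse_coord s)\<^sup>2 = z\<^sup>2" and sgn: "sgn (morse_coord s) = sgn z"
    by (simp_all add: sgn_morse_coord morse_coord_square)
  hence "\<bar>morse_coord s\<bar> = \<bar>z\<bar>" by (metis real_sqrt_abs)
  hence "morse_coord s = z" using sgn by (metis mult_sgn_abs)
  thus ?thesis by auto
qed

lemma morse_inv_continuous: "isCont morse_inv z"
  using isCont_inverse_function[of 1 "morse_inv z" morse_inv morse_coord] by (simp add: morse_coord_continuous)

lemma morse_inv_has_derivative:
  assumes "z \<noteq> 0"
  shows "(morse_inv has_real_derivative 2 * z / (1 - exp (- morse_inv z))) (at z)"
proof (rule DERIV_inner_function[OF toda_has_derivative])
  have "morse_inv z \<noteq> 0" using sgn_morse_inv[of z] assms by (metis sgn_zero_iff)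
  thus "1 - exp (- morse_inv z) \<noteq> 0" by simp
  show "((\<lambda>s. toda (morse_inv s)) has_real_derivative 2 * z) (at z)"
    by (auto simp: toda_morse_inv intro!: derivative_eq_intros)
qed (rule morse_inv_continuous)

lemma real_if_square_nonneg:
  fixes z :: complex
  assumes "z\<^sup>2 = of_real c" "0 \<le> c"
  shows "z \<in> \<real>"
proof -
  have "z\<^sup>2 = (of_real (sqrt c))\<^sup>2" using assms by (simp flip: of_real_power)
  hence "z = of_real (sqrt c) \<or> z = - of_real (sqrt c)" by (simp add: power2_eq_iff)
  thus ?thesis by auto
qed

text \<open>
  The double zero of the complexified potential splits off a holomorphic square root. On the reals
  that root is real, because its square is nonnegative there, and the sign is chosen so that it has the
  sign of the argument.
\<close>

lemma toda_holomorphic_square_root: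
  obtains g r where "0 < r" "g holomorphic_on ball 0 r"
    "\<And>w. w \<in> ball 0 r \<Longrightarrow> exp (- w) + w - 1 = (w * g w)\<^sup>2"
    "\<And>w. w \<in> ball 0 r \<Longrightarrow> 0 < Re (g w)"
    "\<And>s. of_real s \<in> ball (0::complex) r \<Longrightarrow> g (of_real s) \<in> \<real>"
proof -
  define f :: "complex \<Rightarrow> complex" where "f w = exp (- w) + w - 1" for w
  have d1: "deriv f = (\<lambda>w. 1 - exp (- w))"
    unfolding f_def by (rule ext, rule DERIV_imp_deriv) (auto intro!: derivative_eq_intros)
  have d2: "deriv (deriv f) = (\<lambda>w. exp (- w))"
    unfolding d1 by (rule ext, rule DERIV_imp_deriv) (auto intro!: derivative_eq_intros)
  have d2_0: "(deriv ^^ 2) f 0 \<noteq> 0" by (simp add: numeral_2_eq_2 d2)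
  have d1_0: "(deriv ^^ i) f 0 = 0" if "0 < i" "i < 2" for i
  proof -
    have "i = 1" using that by auto
    thus ?thesis by (simp add: d1)
  qed
  have "f holomorphic_on UNIV" unfolding f_def by (intro holomorphic_intros)
  then obtain g r where r: "0 < r" and g: "g holomorphic_on ball 0 r"
    and fg: "\<And>w. w \<in> ball 0 r \<Longrightarrow> f w - f 0 = ((w - 0) * g w)\<^sup>2"
    and gnz: "\<And>w. w \<in> ball 0 r \<Longrightarrow> g w \<noteq> 0"
    by (rule holomorphic_factor_order_of_zero_strong[OF _ open_UNIV UNIV_I zero_less_numeral d2_0])
       (use d1_0 in auto)
  have fg: "f w = (w * g w)\<^sup>2" if "w \<in> ball 0 r" for w
    using fg[OF that] by (simp add: f_def)
  have real: "g (of_real s) \<in> \<real>" if s: "of_real s \<in> ball (0::complex) r" "s \<noteq> 0" for s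
  proof -
    have "(of_real s * g (of_real s))\<^sup>2 = of_real (toda s)"
      using fg[OF s(1)] by (simp add: f_def toda_def exp_of_real flip: of_real_minus)
    hence "of_real s * g (of_real s) \<in> \<real>" using real_if_square_nonneg toda_nonneg by blast
    hence "of_real s * g (of_real s) / of_real s \<in> \<real>" by (intro Reals_divide) auto
    thus ?thesis using s by simp
  qed
  have g_cont: "isCont g 0"
    using holomorphic_on_imp_continuous_on[OF g] r by (simp add: continuous_on_eq_continuous_at)
  \<comment> \<open>At \<open>0\<close> the factor \<open>s\<close> cannot be divided out, but the reals are closed.\<close>
  have real0: "g 0 \<in> \<real>"
  proof -
    have "((\<lambda>s. g (of_real s)) \<longlongrightarrow> g (of_real 0)) (at_right (0::real))"
      by (rule isCont_tendsto_compose[where g = g])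
         (use g_cont tendsto_of_real[OF tendsto_ident_at, of 0 "{0<..}"] in auto)
    moreover have "\<forall>\<^sub>F s in at_right (0::real). g (of_real s) \<in> \<real>"
      using eventually_at_right_less[of 0] eventually_at_right_real[OF r]
      by eventually_elim (auto intro: real)
    ultimately show ?thesis
      using Lim_in_closed_set[OF closed_complex_Reals] by (metis of_real_0 trivial_limit_at_right_real)
  qed
  define \<epsilon> :: complex where "\<epsilon> = (if Re (g 0) > 0 then 1 else -1)"
  have "Re (g 0) \<noteq> 0" using real0 gnz[of 0] r by (auto simp: complex_is_Real_iff complex_eq_iff)
  hence pos: "Re (\<epsilon> * g 0) > 0" by (auto simp: \<epsilon>_def)
  have "((\<lambda>w. Re (\<epsilon> * g w)) \<longlongrightarrow> Re (\<epsilon> * g 0)) (at 0)"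
    using g_cont by (intro tendsto_intros) (auto simp: isCont_def)
  hence "\<forall>\<^sub>F w in at 0. Re (\<epsilon> * g w) > 0" using pos by (rule order_tendstoD)
  then obtain d where d: "d > 0" "\<And>w. w \<noteq> 0 \<Longrightarrow> dist w 0 < d \<Longrightarrow> Re (\<epsilon> * g w) > 0"
    by (auto simp: eventually_at)
  show ?thesis
  proof (rule that[of "min r d" "\<lambda>w. \<epsilon> * g w"])
    show "(\<lambda>w. \<epsilon> * g w) holomorphic_on ball 0 (min r d)"
      by (intro holomorphic_intros holomorphic_on_subset[OF g]) auto
    have "\<epsilon>\<^sup>2 = 1" by (simp add: \<epsilon>_def)
    thus "exp (- w) + w - 1 = (w * (\<epsilon> * g w))\<^sup>2" if "w \<in> ball 0 (min r d)" for w
      using fg[of w] that by (simp add: f_def power_mult_distrib)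
    show "0 < Re (\<epsilon> * g w)" if "w \<in> ball 0 (min r d)" for w
      using d(2)[of w] pos that by (cases "w = 0") auto
    show "\<epsilon> * g (of_real s) \<in> \<real>" if "of_real s \<in> ball (0::complex) (min r d)" for s
      using real[of s] real0 that by (cases "s = 0") (auto simp: \<epsilon>_def)
  qed (use r d in auto)
qed

text \<open>
  The inverse of the Morse coordinate is real analytic at \<open>0\<close>, being the restriction to the reals of a
  holomorphic inverse function.
\<close>

lemma toda_complex_inverse:
  obtains S R where "0 < R" "S holomorphic_on ball 0 R" "S 0 = 0"
    "\<And>z. z \<in> ball 0 R \<Longrightarrow> exp (- S z) + S z - 1 = z\<^sup>2"
    "\<And>t. \<bar>t\<bar> < R \<Longrightarrow> S (of_real t) = of_real (morse_inv t)"
proof -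
  obtain g r where r: "0 < r" and g: "g holomorphic_on ball 0 r"
    and fg: "\<And>w. w \<in> ball 0 r \<Longrightarrow> exp (- w) + w - 1 = (w * g w)\<^sup>2"
    and g_pos: "\<And>w. w \<in> ball 0 r \<Longrightarrow> 0 < Re (g w)"
    and g_real: "\<And>s. of_real s \<in> ball (0::complex) r \<Longrightarrow> g (of_real s) \<in> \<real>"
    by (rule toda_holomorphic_square_root) auto
  define Z where "Z w = w * g w" for w
  have Z: "Z holomorphic_on ball 0 r" unfolding Z_def by (intro holomorphic_intros g)
  have Z0: "Z 0 = 0" by (simp add: Z_def)
  have "deriv Z 0 = g 0"
    unfolding Z_def using holomorphic_derivI[OF g open_ball, of 0] r
    by (intro DERIV_imp_deriv) (auto intro!: derivative_eq_intros)
  moreover have "g 0 \<noteq> 0" using g_pos[of 0] r by auto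
  ultimately have dZ: "deriv Z 0 \<noteq> 0" by simp
  have "\<exists>r2>0. ball (0::complex) r2 \<subseteq> ball 0 r \<and> open (Z ` ball 0 r2) \<and> inj_on Z (ball 0 r2)"
  proof (rule has_complex_derivative_locally_invertible[OF Z _ open_ball dZ])
    show "0 \<in> ball 0 r" using r by simp
  qed (intro exI conjI)
  then obtain r2 where r2: "r2 > 0" "ball (0::complex) r2 \<subseteq> ball 0 r" "open (Z ` ball 0 r2)" "inj_on Z (ball 0 r2)"
    by blast
  have "Z holomorphic_on ball 0 r2" using Z r2(2) by (rule holomorphic_on_subset)
  then obtain S where S: "S holomorphic_on Z ` ball 0 r2" "\<And>w. w \<in> ball 0 r2 \<Longrightarrow> S (Z w) = w"
    by (rule holomorphic_has_inverse[OF _ open_ball r2(4)]) auto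
  have "0 \<in> Z ` ball 0 r2" using r2(1) Z0 by force
  then obtain R0 where R0: "R0 > 0" "ball (0::complex) R0 \<subseteq> Z ` ball 0 r2"
    using r2(3) open_contains_ball by blast
  define \<delta> where "\<delta> = r2 / 2"
  have \<delta>: "\<delta> > 0" "\<And>s. \<bar>s\<bar> \<le> \<delta> \<Longrightarrow> complex_of_real s \<in> ball 0 r2" using r2(1) by (auto simp: \<delta>_def)
  define x where "x s = Re (Z (of_real s))" for s
  have Zx: "Z (of_real s) = of_real (x s)" "sgn (x s) = sgn s" if "\<bar>s\<bar> \<le> \<delta>" for s
  proof -
    have b: "complex_of_real s \<in> ball 0 r" using \<delta>(2)[OF that] r2(2) by blast
    then obtain c where c: "g (of_real s) = of_real c" using g_real Reals_cases by metis
    moreover have "c > 0" using g_pos[OF b] c by simp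
    ultimately show "Z (of_real s) = of_real (x s)" "sgn (x s) = sgn s"
      by (simp_all add: Z_def x_def sgn_mult)
  qed
  have "of_real ` {-\<delta>..\<delta>} \<subseteq> ball (0::complex) r"
  proof safe
    fix s assume "s \<in> {-\<delta>..\<delta>}"
    hence "\<bar>s\<bar> \<le> \<delta>" by auto
    thus "complex_of_real s \<in> ball 0 r" using \<delta>(2) r2(2) by blast
  qed
  hence x_cont: "continuous_on {-\<delta>..\<delta>} x"
    unfolding x_def
    by (intro continuous_intros continuous_on_compose2[OF holomorphic_on_imp_continuous_on[OF Z]]) auto
  have x_sign: "x \<delta> > 0" "x (-\<delta>) < 0" using Zx(2)[of \<delta>] Zx(2)[of "-\<delta>"] \<delta>(1)
    by (auto simp: sgn_real_def split: if_splits)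
  define R where "R = min R0 (min (x \<delta>) (- x (-\<delta>)))"
  show ?thesis
  proof (rule that[of R S])
    show "0 < R" using R0 x_sign by (simp add: R_def)
    show "S holomorphic_on ball 0 R"
      by (rule holomorphic_on_subset[OF S(1)]) (use R0(2) in \<open>auto simp: R_def\<close>)
    show "S 0 = 0" using S(2)[of 0] r2(1) Z0 by simp
    show "exp (- S z) + S z - 1 = z\<^sup>2" if "z \<in> ball 0 R" for z
    proof -
      have "z \<in> ball 0 R0" using that by (simp add: R_def)
      then obtain w where w: "w \<in> ball 0 r2" "z = Z w" using R0(2) by blast
      moreover have "w \<in> ball 0 r" using w(1) r2(2) by blast
      ultimately show ?thesis using fg[of w] S(2)[of w] by (simp add: Z_def)
    qed
    show "S (of_real t) = of_real (morse_inv t)" if "\<bar>t\<bar> < R" for t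
    proof -
      \<comment> \<open>A real point near \<open>0\<close> is the value of the Morse coordinate at a real point, by the
         intermediate value theorem; hence the holomorphic inverse is real on the reals.\<close>
      have "x (-\<delta>) \<le> t" "t \<le> x \<delta>" using that by (auto simp: R_def)
      then obtain s where s: "-\<delta> \<le> s" "s \<le> \<delta>" "x s = t"
        using IVT'[of x "-\<delta>" t \<delta>] x_cont \<delta>(1) by auto
      hence s': "\<bar>s\<bar> \<le> \<delta>" by auto
      have "complex_of_real s \<in> ball 0 r" using \<delta>(2)[OF s'] r2(2) by blast
      from fg[OF this] have "complex_of_real (toda s) = of_real (t\<^sup>2)"
        using Zx(1)[OF s'] s(3) by (simp add: Z_def toda_def exp_of_real flip: of_real_minus)
      hence "toda s = t\<^sup>2" by (simp only: of_real_eq_iff)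
      hence "morse_inv t = s" using Zx(2)[OF s'] s(3) by (intro morse_inv_eqI) auto
      thus ?thesis using S(2)[OF \<delta>(2)[OF s']] Zx(1)[OF s'] s(3) by simp
    qed
  qed
qed

text \<open>
  The value of \<open>\<sigma>/|W|\<close> at the point with Morse coordinate \<open>z\<close>.
\<close>

definition radius :: "real \<Rightarrow> real" where "radius z = exp (morse_inv z / 2)"

lemma morse_inv_0 [simp]: "morse_inv 0 = 0"
  by (rule morse_inv_eqI) auto

lemma radius_pos [simp]: "0 < radius z"
  by (simp add: radius_def)

lemma radius_nonzero [simp]: "radius z \<noteq> 0"
  by (simp add: radius_def)

lemma radius_0 [simp]: "radius 0 = 1"
  by (simp add: radius_def)

lemma morse_inv_strict_mono: "z < z' \<Longrightarrow> morse_inv z < morse_inv z'"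
  by (metis linorder_neqE_linordered_idom morse_coord_morse_inv morse_coord_strict_mono order_less_asym)

lemma radius_strict_mono: "z < z' \<Longrightarrow> radius z < radius z'"
  by (simp add: radius_def morse_inv_strict_mono)

lemma radius_eq_iff: "radius z = radius z' \<longleftrightarrow> z = z'"
  by (metis linorder_neqE_linordered_idom radius_strict_mono order_less_irrefl)

lemma radius_surj: assumes "0 < \<xi>" obtains z where "\<xi> = radius z"
proof
  show "\<xi> = radius (morse_coord (2 * ln \<xi>))" using assms by (simp add: radius_def)
qed

lemma radius_potential: "1 / (2 * (radius z)\<^sup>2) + ln (radius z) = (1 + z\<^sup>2) / 2"
proof -
  have "(radius z)\<^sup>2 = exp (morse_inv z)" by (simp add: radius_def power2_eq_square flip: exp_add)
  hence "1 / (2 * (radius z)\<^sup>2) + ln (radius z) = (1 + toda (morse_inv z)) / 2"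
    by (simp add: radius_def toda_def exp_minus field_simps)
  thus ?thesis by (simp add: toda_morse_inv)
qed

lemma radius_continuous: "isCont radius z"
  unfolding radius_def using morse_inv_continuous by (intro continuous_intros) auto

text \<open>
  Differentiation of \<open>1/(2 r\<^sup>2) + ln r = (1 + z\<^sup>2)/2\<close> gives \<open>r' (r\<^sup>2 - 1) = z r\<^sup>3\<close>. Comparing coefficients up to
  order three determines the expansion of \<open>r\<close> up to the sign of the linear term.
\<close>

lemma radius_coefficients:
  fixes A :: "complex fps"
  assumes ode: "fps_deriv A * (A\<^sup>2 - 1) = fps_X * A ^ 3" and A0: "fps_nth A 0 = 1"
  shows "2 * (fps_nth A 1)\<^sup>2 = 1" "36 * fps_nth A 3 = 11 * fps_nth A 1"
proof -
  define a1 a2 a3 where a: "a1 = fps_nth A 1" "a2 = fps_nth A 2" "a3 = fps_nth A 3"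
  note fps = fps_mult_nth power2_eq_square power3_eq_cube numeral_2_eq_2 numeral_3_eq_3
    sum.atLeast0_atMost_Suc A0
  have e1: "2 * a1\<^sup>2 = 1"
    using arg_cong[OF ode, of "\<lambda>f. fps_nth f 1"] by (simp add: a fps algebra_simps)
  have e2: "6 * a1 * a2 + a1 ^ 3 = 3 * a1"
    using arg_cong[OF ode, of "\<lambda>f. fps_nth f 2"] by (simp add: a fps algebra_simps)
  have e3: "8 * a1 * a3 + 4 * a1\<^sup>2 * a2 + 4 * a2\<^sup>2 = 3 * a2 + 3 * a1\<^sup>2"
    using arg_cong[OF ode, of "\<lambda>f. fps_nth f 3"] by (simp add: a fps algebra_simps)
  have a1: "a1\<^sup>2 = 1 / 2" using e1 by (simp add: field_simps)
  hence "a1 \<noteq> 0" by auto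
  have "a1 * (6 * a2 + a1\<^sup>2 - 3) = 0" using e2 by (simp add: algebra_simps power2_eq_square power3_eq_cube)
  hence "6 * a2 + a1\<^sup>2 - 3 = 0" using \<open>a1 \<noteq> 0\<close> by (simp only: mult_eq_0_iff simp_thms)
  hence a2: "a2 = 5 / 12" using a1 by (simp add: field_simps)
  have "8 * a1 * a3 + 4 * (1 / 2) * (5 / 12) + 4 * (5 / 12)\<^sup>2 = 3 * (5 / 12) + 3 * (1 / 2)"
    using e3 unfolding a1 a2 .
  hence a13: "8 * a1 * a3 = 11 / 9" by (simp add: power2_eq_square field_simps)
  have "36 * a3 = 9 * (8 * a1\<^sup>2 * a3)" by (simp add: a1)
  also have "\<dots> = 9 * (a1 * (8 * a1 * a3))" by (simp add: power2_eq_square)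
  also have "\<dots> = 11 * a1" unfolding a13 by simp
  finally have "36 * a3 = 11 * a1" .
  thus "2 * (fps_nth A 1)\<^sup>2 = 1" "36 * fps_nth A 3 = 11 * fps_nth A 1"
    using e1 by (simp_all add: a)
qed

lemma radius_power_series:
  obtains a :: "nat \<Rightarrow> real" and R where
    "0 < R" "\<And>z. \<bar>z\<bar> < R \<Longrightarrow> (\<lambda>n. a n * z ^ n) sums radius z" "0 < a 1" "a 3 = 11 / 36 * a 1"
proof -
  have ex: "\<exists>S R. 0 < R \<and> S holomorphic_on ball 0 R \<and> S 0 = 0 \<and>
    (\<forall>z\<in>ball 0 R. exp (- S z) + S z - 1 = z\<^sup>2) \<and>
    (\<forall>t. \<bar>t\<bar> < R \<longrightarrow> S (of_real t) = of_real (morse_inv t))"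
    by (rule toda_complex_inverse) blast
  obtain S R where R: "0 < R" and S: "S holomorphic_on ball 0 R" "S 0 = 0"
    "\<And>z. z \<in> ball 0 R \<Longrightarrow> exp (- S z) + S z - 1 = z\<^sup>2"
    "\<And>t. \<bar>t\<bar> < R \<Longrightarrow> S (of_real t) = of_real (morse_inv t)"
    using ex by blast
  define F where "F z = exp (S z / 2)" for z
  define A where "A = fps_expansion F 0"
  have F: "F holomorphic_on ball 0 R" unfolding F_def by (intro holomorphic_intros S) auto
  have FA: "F has_fps_expansion A"
    unfolding A_def using F R by (intro has_fps_expansion_fps_expansion[of "ball 0 R"]) auto
  have ode: "deriv F z * ((F z)\<^sup>2 - 1) = z * F z ^ 3" if z: "z \<in> ball 0 R" for z
  proof -
    have dS: "(S has_field_derivative deriv S z) (at z)"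
      using holomorphic_derivI[OF S(1) open_ball z] .
    have "((\<lambda>z. exp (- S z) + S z - 1) has_field_derivative deriv S z * (1 - exp (- S z))) (at z)"
      by (auto intro!: derivative_eq_intros dS simp: algebra_simps)
    moreover have "((\<lambda>z. exp (- S z) + S z - 1) has_field_derivative 2 * z) (at z)"
      by (rule has_field_derivative_transform_within_open[OF _ open_ball z, of "\<lambda>z. z\<^sup>2"])
         (auto intro!: derivative_eq_intros S(3)[symmetric])
    ultimately have eq: "deriv S z * (1 - exp (- S z)) = 2 * z" by (rule DERIV_unique)
    have dF: "deriv F z = F z * deriv S z / 2"
      unfolding F_def by (rule DERIV_imp_deriv) (auto intro!: derivative_eq_intros dS)
    have F2: "(F z)\<^sup>2 = exp (S z)" by (simp add: F_def power2_eq_square flip: exp_add)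
    have "deriv F z * ((F z)\<^sup>2 - 1) = F z * exp (S z) * (deriv S z * (1 - exp (- S z))) / 2"
      unfolding dF F2 by (simp add: algebra_simps exp_minus)
    also have "\<dots> = z * F z ^ 3"
      unfolding eq F2[symmetric] by (simp add: power2_eq_square power3_eq_cube)
    finally show ?thesis .
  qed
  have "(\<lambda>z. deriv F z * ((F z)\<^sup>2 - 1)) has_fps_expansion fps_deriv A * (A\<^sup>2 - 1)"
    by (intro fps_expansion_intros FA)
  also have "?this \<longleftrightarrow> (\<lambda>z. z * F z ^ 3) has_fps_expansion fps_deriv A * (A\<^sup>2 - 1)"
    using eventually_nhds_in_open[of "ball 0 R" "0::complex"] R
    by (intro has_fps_expansion_cong refl) (auto elim!: eventually_mono simp: ode)
  finally have "(\<lambda>z. z * F z ^ 3) has_fps_expansion fps_deriv A * (A\<^sup>2 - 1)" .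
  moreover have "(\<lambda>z. z * F z ^ 3) has_fps_expansion fps_X * A ^ 3"
    by (intro fps_expansion_intros FA)
  ultimately have A_ode: "fps_deriv A * (A\<^sup>2 - 1) = fps_X * A ^ 3"
    by (rule fps_expansion_unique_complex)
  have A0: "fps_nth A 0 = 1"
    using fps_nth_fps_expansion[OF FA, of 0] S(2) by (simp add: F_def)
  have A_sums: "(\<lambda>n. fps_nth A n * z ^ n) sums F z" if "norm z < R" for z
    using FA F that by (intro has_fps_expansion_imp_sums_complex[where r = R]) auto
  define a where "a n = Re (fps_nth A n)" for n
  have a_sums: "(\<lambda>n. a n * z ^ n) sums radius z" if "\<bar>z\<bar> < R" for z
  proof -
    have "F (of_real z) = of_real (radius z)"
      using S(4)[OF that] by (simp add: F_def radius_def flip: exp_of_real)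
    hence "(\<lambda>n. Re (fps_nth A n * of_real z ^ n)) sums radius z"
      using sums_Re[OF A_sums[of "of_real z"]] that by simp
    thus ?thesis by (simp add: a_def flip: of_real_power)
  qed
  note A13 = radius_coefficients[OF A_ode A0]
  have "fps_nth A 1 \<in> \<real>"
    by (rule real_if_square_nonneg[of _ "1/2"]) (use A13(1) in \<open>auto simp: field_simps\<close>)
  hence a1: "of_real (a 1) = fps_nth A 1" by (simp add: a_def)
  have "a 1 \<noteq> 0" using A13(1) a1 by auto
  moreover have "0 \<le> a 1"
  proof -
    have "(radius has_real_derivative (\<Sum>n. diffs a n * 0 ^ n)) (at 0)"
    proof -
      have "((\<lambda>z. \<Sum>n. a n * z ^ n) has_real_derivative (\<Sum>n. diffs a n * 0 ^ n)) (at 0)"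
        by (rule termdiffs_strong'[of R]) (use a_sums R in \<open>auto simp: sums_iff\<close>)
      thus ?thesis
        by (rule has_field_derivative_transform_within_open[where S = "ball 0 R"])
           (use a_sums R in \<open>auto simp: sums_iff\<close>)
    qed
    hence "(radius has_real_derivative a 1) (at 0)" by (simp add: diffs_def)
    moreover have "mono_on UNIV radius"
      by (intro strict_mono_on_imp_mono_on strict_mono_onI radius_strict_mono)
    ultimately show ?thesis by (intro mono_on_imp_deriv_nonneg[of UNIV radius]) auto
  qed
  ultimately have "0 < a 1" by simp
  moreover have "a 3 = 11 / 36 * a 1"
    using arg_cong[OF A13(2), of Re] by (simp add: a_def)
  ultimately show ?thesis using that[of R a] R a_sums by blast
qed

section \<open>The action of a level curve\<close>

text \<open>
  The power series provides the derivative at the equilibrium \<open>z = 0\<close>, where \<open>toda\<close> is critical and the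
  inverse function rule gives the indeterminate form \<open>0/0\<close>.
\<close>

lemma radius_C1:
  obtains r' where "\<And>z. (radius has_real_derivative r' z) (at z)" "continuous_on UNIV r'" "\<And>z. 0 < r' z"
proof -
  have ex: "\<exists>a R. 0 < R \<and> (\<forall>z. \<bar>z\<bar> < R \<longrightarrow> (\<lambda>n. a n * z ^ n) sums radius z) \<and> (0::real) < a 1"
    by (rule radius_power_series) blast
  then obtain a R where R: "0 < R" "\<And>z. \<bar>z\<bar> < R \<Longrightarrow> (\<lambda>n. a n * z ^ n) sums radius z" "(0::real) < a 1"
    by blast
  define p where "p z = (\<Sum>n. diffs a n * z ^ n)" for z
  have p: "(radius has_real_derivative p z) (at z)" if z: "\<bar>z\<bar> < R" for z
  proof -
    have "((\<lambda>z. \<Sum>n. a n * z ^ n) has_real_derivative p z) (at z)"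
      unfolding p_def by (rule termdiffs_strong'[of R]) (use R(2) z in \<open>auto simp: sums_iff\<close>)
    thus ?thesis
      by (rule has_field_derivative_transform_within_open[where S = "ball 0 R"])
         (use R(2) z in \<open>auto simp: sums_iff\<close>)
  qed
  have p0: "p 0 = a 1" by (simp add: p_def diffs_def)
  have p_cont: "isCont p 0"
  proof -
    have "summable (\<lambda>n. diffs a n * z ^ n)" if "norm z < R" for z
      using that R(2) by (intro termdiff_converges[of z R]) (auto simp: sums_iff)
    hence "(p has_real_derivative (\<Sum>n. diffs (diffs a) n * 0 ^ n)) (at 0)"
      unfolding p_def by (rule termdiffs_strong'[of R]) (use R(1) in auto)
    thus ?thesis by (rule DERIV_isCont)
  qed
  define q where "q z = radius z * z / (1 - 1 / (radius z)\<^sup>2)" for z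
  have r1: "radius z > 1 \<longleftrightarrow> z > 0" "radius z < 1 \<longleftrightarrow> z < 0" for z
    using radius_strict_mono[of 0 z] radius_strict_mono[of z 0] by (cases z "0::real" rule: linorder_cases; simp)+
  have q: "(radius has_real_derivative q z) (at z)" if "z \<noteq> 0" for z
  proof -
    have "exp (- morse_inv z) = 1 / (radius z)\<^sup>2"
      by (simp add: radius_def power2_eq_square exp_minus field_simps flip: exp_add)
    moreover have "(radius has_real_derivative radius z * (2 * z / (1 - exp (- morse_inv z)) / 2)) (at z)"
      unfolding radius_def[abs_def] by (intro DERIV_fun_exp DERIV_cdivide morse_inv_has_derivative that)
    moreover have "2 * z / D / 2 = z / D" for D :: real by simp
    ultimately show ?thesis by (simp only: q_def times_divide_eq_right)
  qed
  have q_pos: "q z > 0" if "z \<noteq> 0" for z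
  proof (cases "z > 0")
    case True
    hence "1 < (radius z)\<^sup>2" using one_less_power[of "radius z" 2] r1 by simp
    thus ?thesis using True by (simp add: q_def)
  next
    case False
    hence z: "z < 0" "radius z < 1" using that r1 by auto
    hence "(radius z)\<^sup>2 < 1" using power_strict_mono[of "radius z" 1 2] by (simp add: less_imp_le)
    hence "1 < 1 / (radius z)\<^sup>2" by simp
    thus ?thesis using z unfolding q_def by (intro divide_neg_neg mult_pos_neg) auto
  qed
  define r' where "r' z = (if z = 0 then p z else q z)" for z
  have r': "(radius has_real_derivative r' z) (at z)" for z
    using p[of z] q[of z] R(1) by (auto simp: r'_def)
  have "isCont r' z" for z
  proof (cases "z = 0")
    case True
    have "r' w = p w" if "w \<in> ball 0 R" for w
      using DERIV_unique[OF r'[of w] p[of w]] that by simp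
    hence "\<forall>\<^sub>F w in nhds 0. r' w = p w"
      using eventually_nhds_in_open[of "ball 0 R" "0::real"] R(1) by (auto elim!: eventually_mono)
    thus ?thesis using p_cont True isCont_cong by blast
  next
    case False
    have near: "\<forall>\<^sub>F w in nhds z. r' w = q w"
      using t1_space_nhds[OF False] by eventually_elim (simp add: r'_def)
    have "radius z \<noteq> 1" using radius_eq_iff[of z 0] False by simp
    moreover have "radius z \<noteq> -1" using radius_pos[of z] by linarith
    ultimately have "(radius z)\<^sup>2 \<noteq> 1" by (simp add: power2_eq_1_iff)
    hence "isCont q z"
      unfolding q_def using radius_continuous by (intro continuous_intros) auto
    thus ?thesis using near isCont_cong by blast
  qed
  hence "continuous_on UNIV r'" by (simp add: continuous_on_eq_continuous_at)
  moreover have "0 < r' z" for z using q_pos[of z] p0 R(3) by (auto simp: r'_def)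
  ultimately show ?thesis using that[of r'] r' by blast
qed

text \<open>
  The action of the level curve \<open>z\<^sup>2 + \<Sigma>\<^sup>2 = \<rho>\<^sup>2\<close> for \<open>|W| = 1\<close>. The enclosed area is \<open>\<integral> \<sigma> d\<Sigma>\<close> over a period of
  the angle, folded here onto half a period. In this form the integrand is even in \<open>\<rho>\<close> and monotone in
  \<open>|\<rho>|\<close>.
\<close>

definition unit_action :: "real \<Rightarrow> real" where
  "unit_action \<rho> =
     integral {0..pi} (\<lambda>\<theta>. \<rho> * cos \<theta> * (radius (\<rho> * cos \<theta>) - radius (- (\<rho> * cos \<theta>)))) / (2 * pi)"

lemma radius_continuous_on [continuous_intros]:
  "continuous_on A f \<Longrightarrow> continuous_on A (\<lambda>x. radius (f x))"
  by (rule continuous_on_compose2[of UNIV radius])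
     (auto simp: radius_continuous intro: continuous_at_imp_continuous_on)

text \<open>
  Monotonicity separates the energy levels: a point of high energy cannot share its action and its
  momenta with a point near the equilibria, although the small actions are inverted only locally.
\<close>

lemma unit_action_mono:
  assumes "0 \<le> \<rho>" "\<rho> \<le> \<rho>'"
  shows "unit_action \<rho> \<le> unit_action \<rho>'"
proof -
  define \<kappa> where "\<kappa> z = z * (radius z - radius (- z))" for z
  \<comment> \<open>For positive arguments both factors are nonnegative and increasing.\<close>
  have mono: "\<kappa> z \<le> \<kappa> z'" if "0 \<le> z" "z \<le> z'" for z z'
  proof -
    have le: "radius x \<le> radius y" if "x \<le> y" for x y
      using radius_strict_mono[of x y] that by (cases "x = y") auto
    show ?thesis
      unfolding \<kappa>_def using that le[of z z'] le[of "-z'" "-z"] le[of "-z'" z'] le[of "-z" z]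
      by (intro mult_mono) auto
  qed
  have even: "\<kappa> (- z) = \<kappa> z" for z by (simp add: \<kappa>_def algebra_simps)
  have "\<kappa> (\<rho> * c) \<le> \<kappa> (\<rho>' * c)" for c
  proof (cases "0 \<le> c")
    case True
    thus ?thesis using assms by (intro mono mult_right_mono mult_nonneg_nonneg) auto
  next
    case False
    hence "\<kappa> (\<rho> * (- c)) \<le> \<kappa> (\<rho>' * (- c))"
      using assms by (intro mono mult_right_mono mult_nonneg_nonneg) auto
    thus ?thesis by (simp add: even)
  qed
  hence "integral {0..pi} (\<lambda>\<theta>. \<kappa> (\<rho> * cos \<theta>)) \<le> integral {0..pi} (\<lambda>\<theta>. \<kappa> (\<rho>' * cos \<theta>))"
    unfolding \<kappa>_def by (intro integral_le integrable_continuous_interval continuous_intros) auto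
  thus ?thesis by (simp add: unit_action_def \<kappa>_def divide_right_mono)
qed

lemma unit_action_0 [simp]: "unit_action 0 = 0"
  by (simp add: unit_action_def)

text \<open>
  Integration by parts turns \<open>\<integral> y dx\<close> into \<open>-\<integral> x dy\<close>; a shift of the angle by \<open>\<pi>\<close> folds the period.
\<close>

lemma area_inside_level_curve:
  assumes r': "\<And>z. (radius has_real_derivative r' z) (at z)" "continuous_on UNIV r'" and "0 \<le> \<rho>"
  shows "\<bar>integral {0..2 * pi} (\<lambda>\<theta>. \<rho> * sin \<theta> * (r' (\<rho> * cos \<theta>) * (- (\<rho> * sin \<theta>))))\<bar>
           = 2 * pi * unit_action \<rho>"
proof -
  let ?ydx = "\<lambda>\<theta>. \<rho> * sin \<theta> * (r' (\<rho> * cos \<theta>) * (- (\<rho> * sin \<theta>)))"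
  let ?xdy = "\<lambda>\<theta>. \<rho> * cos \<theta> * radius (\<rho> * cos \<theta>)"
  have r'_cont: "continuous_on A (\<lambda>\<theta>. r' (\<rho> * cos \<theta>))" for A
    by (intro continuous_on_compose2[OF r'(2)] continuous_intros) auto
  have int: "?ydx integrable_on {a..b}" "?xdy integrable_on {a..b}" for a b
    by (intro integrable_continuous_interval continuous_intros r'_cont)+
  have "((\<lambda>\<theta>. radius (\<rho> * cos \<theta>) * (\<rho> * sin \<theta>)) has_real_derivative ?ydx \<theta> + ?xdy \<theta>) (at \<theta>)" for \<theta>
    by (auto intro!: derivative_eq_intros DERIV_chain2[OF r'(1)] simp: algebra_simps)
  hence "((\<lambda>\<theta>. ?ydx \<theta> + ?xdy \<theta>) has_integral
           radius (\<rho> * cos (2 * pi)) * (\<rho> * sin (2 * pi)) - radius (\<rho> * cos 0) * (\<rho> * sin 0)) {0..2 * pi}"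
    by (intro fundamental_theorem_of_calculus)
       (auto simp: has_real_derivative_iff_has_vector_derivative intro: has_vector_derivative_at_within)
  hence "integral {0..2 * pi} (\<lambda>\<theta>. ?ydx \<theta> + ?xdy \<theta>) = 0" by (auto simp: integral_unique)
  hence *: "integral {0..2 * pi} ?ydx = - integral {0..2 * pi} ?xdy"
    using integral_add[OF int[where a = 0 and b = "2 * pi"]] by linarith
  have "integral {0..2 * pi} ?xdy = integral {0..pi} ?xdy + integral {pi..2 * pi} ?xdy"
    using Henstock_Kurzweil_Integration.integral_combine[of 0 pi "2 * pi" ?xdy] int by simp
  also have "integral {pi..2 * pi} ?xdy = integral {0..pi} (?xdy \<circ> (+) pi)"
    using integral_shift_Icc_real[of 0 pi ?xdy pi] by simp
  also have "integral {0..pi} ?xdy + integral {0..pi} (?xdy \<circ> (+) pi) =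
               integral {0..pi} (\<lambda>\<theta>. ?xdy \<theta> + (?xdy \<circ> (+) pi) \<theta>)"
    unfolding o_def
    by (rule integral_add[symmetric]) (intro integrable_continuous_interval continuous_intros)+
  also have "(\<lambda>\<theta>. ?xdy \<theta> + (?xdy \<circ> (+) pi) \<theta>) =
      (\<lambda>\<theta>. \<rho> * cos \<theta> * (radius (\<rho> * cos \<theta>) - radius (- (\<rho> * cos \<theta>))))"
    by (simp add: fun_eq_iff algebra_simps)
  finally have "integral {0..2 * pi} ?xdy = 2 * pi * unit_action \<rho>"
    by (simp add: unit_action_def)
  moreover have "0 \<le> unit_action \<rho>" using unit_action_mono[of 0 \<rho>] assms(3) by simp
  ultimately show ?thesis using * by (simp add: abs_mult)
qed

text \<open>
  Scaling \<open>\<sigma>\<close> by \<open>|W|\<close> changes the energy only by the additive term \<open>ln |W|\<close>.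
\<close>

lemma nose_limit_at_radius:
  assumes "0 < conorm2 g (sqrt M *\<^sub>R w) W"
  shows "nose_limit g M (sqrt (conorm2 g (sqrt M *\<^sub>R w) W) * radius z, w, y, W) =
           1 / 2 + ln (conorm2 g (sqrt M *\<^sub>R w) W) / 2 + (z\<^sup>2 + y\<^sup>2) / 2"
proof -
  define a where "a = conorm2 g (sqrt M *\<^sub>R w) W"
  have "a > 0" using assms by (simp add: a_def)
  have "nose_limit g M (sqrt a * radius z, w, y, W) =
      (inverse (sqrt a * radius z))\<^sup>2 * a / 2 + y\<^sup>2 / 2 + ln (sqrt a * radius z)"
    by (simp add: nose_limit_def conorm2_scaleR a_def)
  also have "(inverse (sqrt a * radius z))\<^sup>2 * a / 2 = 1 / (2 * (radius z)\<^sup>2)"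
    using \<open>a > 0\<close> by (simp add: power_mult_distrib power_inverse field_simps)
  also have "ln (sqrt a * radius z) = ln a / 2 + ln (radius z)"
    using \<open>a > 0\<close> by (simp add: ln_mult ln_sqrt)
  finally show ?thesis using radius_potential[of z] unfolding a_def by (simp add: add_divide_distrib)
qed

text \<open>
  In the coordinates \<open>(z, \<Sigma>)\<close> every level curve is a circle about the origin; at an equilibrium its radius is \<open>0\<close>.
\<close>

lemma level_curve_nose_limit:
  fixes g M w W \<sigma> S
  defines "a \<equiv> conorm2 g (sqrt M *\<^sub>R w) W"
  defines "\<rho> \<equiv> sqrt (2 * (nose_limit g M (\<sigma>, w, S, W) - 1 / 2 - ln a / 2))"
  assumes "0 < a" "0 < \<sigma>"
  shows "0 \<le> nose_limit g M (\<sigma>, w, S, W) - 1 / 2 - ln a / 2"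
    and "level_curve (nose_limit g M) (\<sigma>, w, S, W) =
           (\<lambda>u. (sqrt a * radius (\<rho> * Re u), \<rho> * Im u)) ` sphere 0 1"
proof -
  have F: "nose_limit g M (sqrt a * radius z, w, y, W) = 1 / 2 + ln a / 2 + (z\<^sup>2 + y\<^sup>2) / 2" for z y
    using nose_limit_at_radius assms(3) unfolding a_def by blast
  have surj: "\<exists>z. x = sqrt a * radius z" if "x > 0" for x
    using radius_surj[of "x / sqrt a"] that \<open>0 < a\<close> by (metis divide_pos_pos real_sqrt_gt_zero
       nonzero_mult_div_cancel_left times_divide_eq_right order_less_irrefl)
  obtain z0 where z0: "\<sigma> = sqrt a * radius z0" using surj \<open>0 < \<sigma>\<close> by blast
  have e: "nose_limit g M (\<sigma>, w, S, W) - 1 / 2 - ln a / 2 = (z0\<^sup>2 + S\<^sup>2) / 2"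
    unfolding z0 F by simp
  show "0 \<le> nose_limit g M (\<sigma>, w, S, W) - 1 / 2 - ln a / 2" unfolding e by simp
  have \<rho>: "0 \<le> \<rho>" "\<rho>\<^sup>2 = z0\<^sup>2 + S\<^sup>2" unfolding \<rho>_def e by simp_all
  have "(x, y) \<in> level_curve (nose_limit g M) (\<sigma>, w, S, W) \<longleftrightarrow>
        (\<exists>z. x = sqrt a * radius z \<and> z\<^sup>2 + y\<^sup>2 = \<rho>\<^sup>2)" for x y
  proof -
    have "(x, y) \<in> level_curve (nose_limit g M) (\<sigma>, w, S, W) \<longleftrightarrow>
          x > 0 \<and> nose_limit g M (x, w, y, W) = nose_limit g M (\<sigma>, w, S, W)"
      by (simp add: level_curve_def)
    also have "\<dots> \<longleftrightarrow> (\<exists>z. x = sqrt a * radius z \<and> z\<^sup>2 + y\<^sup>2 = \<rho>\<^sup>2)"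
    proof
      assume x: "x > 0 \<and> nose_limit g M (x, w, y, W) = nose_limit g M (\<sigma>, w, S, W)"
      then obtain z where "x = sqrt a * radius z" using surj by blast
      thus "\<exists>z. x = sqrt a * radius z \<and> z\<^sup>2 + y\<^sup>2 = \<rho>\<^sup>2" using x by (intro exI[of _ z]) (simp add: z0 F \<rho>)
    next
      assume "\<exists>z. x = sqrt a * radius z \<and> z\<^sup>2 + y\<^sup>2 = \<rho>\<^sup>2"
      thus "x > 0 \<and> nose_limit g M (x, w, y, W) = nose_limit g M (\<sigma>, w, S, W)"
        using \<open>0 < a\<close> by (auto simp: z0 F \<rho>)
    qed
    finally show ?thesis .
  qed
  moreover have "(\<exists>z. x = sqrt a * radius z \<and> z\<^sup>2 + y\<^sup>2 = \<rho>\<^sup>2) \<longleftrightarrow>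
     (x, y) \<in> (\<lambda>u. (sqrt a * radius (\<rho> * Re u), \<rho> * Im u)) ` sphere 0 1" for x y
  proof
    assume "\<exists>z. x = sqrt a * radius z \<and> z\<^sup>2 + y\<^sup>2 = \<rho>\<^sup>2"
    then obtain z where z: "x = sqrt a * radius z" "z\<^sup>2 + y\<^sup>2 = \<rho>\<^sup>2" by blast
    have "\<exists>u. norm u = 1 \<and> z = \<rho> * Re u \<and> y = \<rho> * Im u"
    proof (cases "\<rho> = 0")
      case True
      hence "z = 0" "y = 0" using z(2) by (auto simp: sum_power2_eq_zero_iff)
      thus ?thesis using True by (intro exI[of _ 1]) auto
    next
      case False
      have "norm (Complex (z / \<rho>) (y / \<rho>)) = 1"
        using False z(2) by (simp add: cmod_def power_divide flip: add_divide_distrib)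
      thus ?thesis using False by (intro exI[of _ "Complex (z / \<rho>) (y / \<rho>)"]) auto
    qed
    thus "(x, y) \<in> (\<lambda>u. (sqrt a * radius (\<rho> * Re u), \<rho> * Im u)) ` sphere 0 1"
      using z(1) by (auto simp: image_iff)
  next
    assume "(x, y) \<in> (\<lambda>u. (sqrt a * radius (\<rho> * Re u), \<rho> * Im u)) ` sphere 0 1"
    then obtain u where u: "norm u = 1" "x = sqrt a * radius (\<rho> * Re u)" "y = \<rho> * Im u" by auto
    have "(Re u)\<^sup>2 + (Im u)\<^sup>2 = 1" using u(1) by (simp add: cmod_def)
    hence "(\<rho> * Re u)\<^sup>2 + (\<rho> * Im u)\<^sup>2 = \<rho>\<^sup>2"
      by (simp add: power_mult_distrib flip: distrib_left)
    thus "\<exists>z. x = sqrt a * radius z \<and> z\<^sup>2 + y\<^sup>2 = \<rho>\<^sup>2" using u by blast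
  qed
  ultimately show "level_curve (nose_limit g M) (\<sigma>, w, S, W) =
           (\<lambda>u. (sqrt a * radius (\<rho> * Re u), \<rho> * Im u)) ` sphere 0 1"
    by (auto simp: set_eq_iff)
qed

lemma action_nose_limit:
  fixes g M w W \<sigma> S
  defines "a \<equiv> conorm2 g (sqrt M *\<^sub>R w) W"
  assumes "0 < a" "0 < \<sigma>"
  shows "action (nose_limit g M) (\<sigma>, w, S, W) =
           sqrt a * unit_action (sqrt (2 * (nose_limit g M (\<sigma>, w, S, W) - 1 / 2 - ln a / 2)))"
proof -
  define \<rho> where "\<rho> = sqrt (2 * (nose_limit g M (\<sigma>, w, S, W) - 1 / 2 - ln a / 2))"
  define e where "e u = (sqrt a * radius (\<rho> * Re u), \<rho> * Im u)" for u
  have L: "level_curve (nose_limit g M) (\<sigma>, w, S, W) = e ` sphere 0 1" and "0 \<le> \<rho>"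
    using level_curve_nose_limit[OF assms(2,3)[unfolded a_def], of S]
    by (simp_all add: \<rho>_def e_def[abs_def] a_def)
  obtain r' where r': "\<And>z. (radius has_real_derivative r' z) (at z)" "continuous_on UNIV r'" "\<And>z. 0 < r' z"
    by (rule radius_C1) auto
  define x' where "x' \<theta> = sqrt a * (r' (\<rho> * cos \<theta>) * (- (\<rho> * sin \<theta>)))" for \<theta>
  have x': "((\<lambda>\<theta>. fst (e (cis \<theta>))) has_real_derivative x' \<theta>) (at \<theta>)" for \<theta>
    unfolding e_def x'_def by (auto intro!: derivative_eq_intros DERIV_chain2[OF r'(1)])
  have x'_cont: "continuous_on UNIV x'"
    unfolding x'_def by (intro continuous_intros continuous_on_compose2[OF r'(2)]) auto
  have y': "((\<lambda>\<theta>. snd (e (cis \<theta>))) has_real_derivative \<rho> * cos \<theta>) (at \<theta>)" for \<theta>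
    unfolding e_def by (auto intro!: derivative_eq_intros)
  consider "\<rho> = 0" | "0 < \<rho>" using \<open>0 \<le> \<rho>\<close> by linarith
  hence "(\<exists>\<gamma>. parametrizes \<gamma> (e ` sphere 0 1)) \<and>
        (\<forall>\<gamma>. parametrizes \<gamma> (e ` sphere 0 1) \<longrightarrow>
           \<bar>line_integral_ydx \<gamma>\<bar> = 2 * pi * (sqrt a * unit_action \<rho>))"
  proof cases
    case 1
    have "e u = (sqrt a, 0)" for u using 1 by (simp add: e_def)
    hence im: "e ` sphere 0 1 = {(sqrt a, 0)}" by (auto intro: image_eqI[of _ _ 1])
    have "parametrizes (linepath (sqrt a, 0) (sqrt a, 0)) (e ` sphere 0 1)"
      unfolding parametrizes_def im by auto
    moreover have "line_integral_ydx \<gamma> = 0" if "parametrizes \<gamma> (e ` sphere 0 1)" for \<gamma>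
    proof -
      have "\<gamma> t = (sqrt a, 0)" if "t \<in> {0..1}" for t
        using \<open>parametrizes \<gamma> _\<close> that by (auto simp: parametrizes_def im path_image_def)
      hence "line_integral_ydx \<gamma> = integral {0..1} (\<lambda>t::real. 0::real)"
        unfolding line_integral_ydx_def by (intro integral_cong) auto
      thus ?thesis by simp
    qed
    ultimately show ?thesis using 1 by auto
  next
    case 2
    have inj: "inj_on e (sphere 0 1)"
    proof (rule inj_onI)
      fix u v assume "e u = e v"
      hence "sqrt a * radius (\<rho> * Re u) = sqrt a * radius (\<rho> * Re v)" "\<rho> * Im u = \<rho> * Im v"
        by (simp_all add: e_def)
      thus "u = v" using 2 \<open>0 < a\<close> by (auto simp: radius_eq_iff complex_eq_iff)
    qed
    have cont: "continuous_on (sphere 0 1) e"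
      unfolding e_def by (intro continuous_intros)
    have immersed: "x' \<theta> \<noteq> 0 \<or> \<rho> * cos \<theta> \<noteq> 0" for \<theta>
      using sin_zero_abs_cos_one[of \<theta>] 2 \<open>0 < a\<close> r'(3)[of "\<rho> * cos \<theta>"] by (auto simp: x'_def)
    have not_point: "e ` sphere 0 1 \<noteq> {z}" for z
    proof
      assume "e ` sphere 0 1 = {z}"
      moreover have "\<i> \<in> sphere 0 1" "- \<i> \<in> sphere 0 1" by simp_all
      ultimately have "e \<i> = e (- \<i>)" by (metis imageI singletonD)
      thus False using 2 by (simp add: e_def)
    qed
    have "continuous_on UNIV (\<lambda>\<theta>. \<rho> * cos \<theta>)" by (intro continuous_intros)
    hence "parametrizes (\<lambda>t. e (cis (2 * pi * t))) (e ` sphere 0 1)"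
      by (rule parametrizes_circle_image[OF inj x' x'_cont y'])
    moreover have "\<bar>line_integral_ydx \<gamma>\<bar> = 2 * pi * (sqrt a * unit_action \<rho>)"
      if "parametrizes \<gamma> (e ` sphere 0 1)" for \<gamma>
    proof -
      have "\<bar>line_integral_ydx \<gamma>\<bar> = \<bar>integral {0..2 * pi} (\<lambda>\<theta>. snd (e (cis \<theta>)) * x' \<theta>)\<bar>"
        using that not_point
        by (intro line_integral_simple_loop[OF cont inj x' x'_cont y' immersed])
           (auto simp: parametrizes_def)
      also have "(\<lambda>\<theta>. snd (e (cis \<theta>)) * x' \<theta>) =
          (\<lambda>\<theta>. sqrt a * (\<rho> * sin \<theta> * (r' (\<rho> * cos \<theta>) * (- (\<rho> * sin \<theta>)))))"
        by (auto simp: e_def x'_def)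
      finally show ?thesis
        using area_inside_level_curve[OF r'(1,2) \<open>0 \<le> \<rho>\<close>] \<open>0 < a\<close>
        by (simp add: abs_mult)
    qed
    ultimately show ?thesis by blast
  qed
  then obtain \<gamma> where "parametrizes \<gamma> (e ` sphere 0 1)"
    and area: "\<And>\<gamma>. parametrizes \<gamma> (e ` sphere 0 1) \<Longrightarrow>
             \<bar>line_integral_ydx \<gamma>\<bar> = 2 * pi * (sqrt a * unit_action \<rho>)" by blast
  thus ?thesis
    unfolding action_def L \<rho>_def[symmetric]
    by (intro the_equality) (auto simp: area intro!: exI[of _ \<gamma>])
qed

section \<open>The action as a power series in the energy\<close>

lemma integral_cos_squared: "integral {0..pi} (\<lambda>\<theta>. cos \<theta> ^ 2) = pi / 2"
proof -
  have "((\<lambda>\<theta>. (\<theta> + sin \<theta> * cos \<theta>) / 2) has_real_derivative cos \<theta> ^ 2) (at \<theta>)" for \<theta> :: real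
  proof -
    have "((\<lambda>\<theta>. (\<theta> + sin \<theta> * cos \<theta>) / 2) has_real_derivative
             (1 + (cos \<theta> * cos \<theta> - sin \<theta> * sin \<theta>)) / 2) (at \<theta>)"
      by (auto intro!: derivative_eq_intros)
    moreover have "sin \<theta> * sin \<theta> = 1 - cos \<theta> * cos \<theta>"
      using sin_cos_squared_add[of \<theta>] by (simp add: power2_eq_square)
    ultimately show ?thesis by (simp add: power2_eq_square)
  qed
  hence "((\<lambda>\<theta>. cos \<theta> ^ 2) has_integral (pi + sin pi * cos pi) / 2 - (0 + sin 0 * cos 0) / 2) {0..pi}"
    by (intro fundamental_theorem_of_calculus)
       (auto simp: has_real_derivative_iff_has_vector_derivative intro: has_vector_derivative_at_within)
  thus ?thesis by (simp add: integral_unique)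
qed

lemma integral_cos_fourth: "integral {0..pi} (\<lambda>\<theta>. cos \<theta> ^ 4) = 3 * pi / 8"
proof -
  let ?G = "\<lambda>\<theta>::real. 3 / 8 * \<theta> + 3 / 8 * (sin \<theta> * cos \<theta>) + 1 / 4 * (sin \<theta> * cos \<theta> ^ 3)"
  have "(?G has_real_derivative cos \<theta> ^ 4) (at \<theta>)" for \<theta> :: real
  proof -
    have s: "sin \<theta> * sin \<theta> = 1 - cos \<theta> * cos \<theta>"
      using sin_cos_squared_add[of \<theta>] by (simp add: power2_eq_square)
    have "(?G has_real_derivative 3 / 8 + 3 / 8 * (cos \<theta> * cos \<theta> - sin \<theta> * sin \<theta>)
        + 1 / 4 * (cos \<theta> * cos \<theta> ^ 3 - 3 * cos \<theta> ^ 2 * (sin \<theta> * sin \<theta>))) (at \<theta>)"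
      by (auto intro!: derivative_eq_intros simp: field_simps)
    moreover have "3 / 8 + 3 / 8 * (c * c - (1 - c * c)) + 1 / 4 * (c * c ^ 3 - 3 * c ^ 2 * (1 - c * c)) = c ^ 4"
      for c :: real by (simp add: field_simps power2_eq_square power3_eq_cube power4_eq_xxxx)
    ultimately show ?thesis by (simp only: s)
  qed
  hence "((\<lambda>\<theta>. cos \<theta> ^ 4) has_integral ?G pi - ?G 0) {0..pi}"
    by (intro fundamental_theorem_of_calculus)
       (auto simp: has_real_derivative_iff_has_vector_derivative intro: has_vector_derivative_at_within)
  thus ?thesis by (simp add: integral_unique)
qed

lemma integral_sums:
  fixes f :: "nat \<Rightarrow> real \<Rightarrow> real"
  assumes sums: "\<And>x. x \<in> {a..b} \<Longrightarrow> (\<lambda>k. f k x) sums g x"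
    and cont: "\<And>k. continuous_on {a..b} (f k)"
    and bound: "\<And>k x. x \<in> {a..b} \<Longrightarrow> \<bar>f k x\<bar> \<le> m k" "summable m"
  shows "(\<lambda>k. integral {a..b} (f k)) sums integral {a..b} g"
proof -
  have u: "uniform_limit {a..b} (\<lambda>n x. \<Sum>k<n. f k x) (\<lambda>x. \<Sum>k. f k x) sequentially"
    using bound by (intro Weierstrass_m_test) auto
  have c: "continuous_on {a..b} (\<lambda>x. \<Sum>k<n. f k x)" for n
    by (intro continuous_intros cont)
  obtain I J where I: "\<And>n. ((\<lambda>x. \<Sum>k<n. f k x) has_integral I n) {a..b}"
    and J: "((\<lambda>x. \<Sum>k. f k x) has_integral J) {a..b}" and lim: "I \<longlonglongrightarrow> J"
    by (rule uniform_limit_integral[OF u c sequentially_bot]) auto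
  have "I n = (\<Sum>k<n. integral {a..b} (f k))" for n
    using integral_unique[OF I[of n]]
    by (subst (asm) integral_sum) (auto intro: integrable_continuous_interval cont)
  hence "I = (\<lambda>n. \<Sum>k<n. integral {a..b} (f k))" by auto
  moreover have "J = integral {a..b} g"
  proof -
    have "J = integral {a..b} (\<lambda>x. \<Sum>k. f k x)" using J by (simp add: integral_unique)
    also have "\<dots> = integral {a..b} g" by (intro integral_cong) (use sums in \<open>auto simp: sums_iff\<close>)
    finally show ?thesis .
  qed
  ultimately show ?thesis using lim by (simp add: sums_def)
qed

text \<open>
  Only the odd coefficients of \<open>radius\<close> survive in the even integrand of \<open>unit_action\<close>, so the action is a
  power series in the energy \<open>\<rho>\<^sup>2/2\<close>. Its sum for negative arguments is the smooth extension beyond the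
  equilibria. The second derivative at \<open>0\<close> is \<open>11/12\<close> of the first; that this ratio is not \<open>1\<close> is what makes the
  Hamiltonian non-degenerate.
\<close>

lemma unit_action_power_series:
  obtains b :: "nat \<Rightarrow> real" and \<epsilon> where
    "0 < \<epsilon>" "\<And>e. \<bar>e\<bar> < \<epsilon> \<Longrightarrow> summable (\<lambda>k. b k * e ^ k)"
    "\<And>\<rho>. 0 \<le> \<rho> \<Longrightarrow> \<rho>\<^sup>2 / 2 < \<epsilon> \<Longrightarrow> unit_action \<rho> = (\<Sum>k. b k * (\<rho>\<^sup>2 / 2) ^ k)"
    "b 0 = 0" "0 < b 1" "2 * b 2 = 11 / 12 * b 1"
proof -
  have "\<exists>a R. 0 < R \<and> (\<forall>z. \<bar>z\<bar> < R \<longrightarrow> (\<lambda>n. a n * z ^ n) sums radius z) \<and> (0::real) < a 1 \<and> a 3 = 11 / 36 * a 1"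
    by (rule radius_power_series) blast
  then obtain a R where R: "0 < R" and a: "\<And>z. \<bar>z\<bar> < R \<Longrightarrow> (\<lambda>n. a n * z ^ n) sums radius z"
    "(0::real) < a 1" "a 3 = 11 / 36 * a 1" by blast
  have odd_sums: "(\<lambda>k. 2 * a (2 * k + 1) * z ^ (2 * k + 2)) sums (z * (radius z - radius (- z)))"
    if "\<bar>z\<bar> < R" for z
  proof -
    have "(\<lambda>n. z * (a n * z ^ n - a n * (- z) ^ n)) sums (z * (radius z - radius (- z)))"
      using that by (intro sums_mult sums_diff a) auto
    moreover have "z * (a n * z ^ n - a n * (- z) ^ n) = 0" if "n \<notin> range (\<lambda>k. 2 * k + 1)" for n
    proof -
      have "even n" using that by (metis oddE rangeI)
      thus ?thesis by simp
    qed
    moreover have "strict_mono (\<lambda>k::nat. 2 * k + 1)" by (auto simp: strict_mono_def)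
    ultimately have "(\<lambda>k. z * (a (2 * k + 1) * z ^ (2 * k + 1) - a (2 * k + 1) * (- z) ^ (2 * k + 1)))
        sums (z * (radius z - radius (- z)))"
      using sums_mono_reindex[of "\<lambda>k. 2 * k + 1" "\<lambda>n. z * (a n * z ^ n - a n * (- z) ^ n)"] by simp
    thus ?thesis by (simp add: algebra_simps)
  qed
  have abs_summable: "summable (\<lambda>k. \<bar>2 * a (2 * k + 1) * z ^ (2 * k + 2)\<bar>)" if zR: "\<bar>z\<bar> < R" for z
  proof -
    obtain y where y: "\<bar>z\<bar> < y" "y < R" using dense[OF zR] by blast
    have "summable (\<lambda>n. \<bar>a n * z ^ n\<bar>)"
      using powser_insidea[of a y z] a(1)[of y] y by (auto simp: sums_iff)
    hence "summable (\<lambda>k. \<bar>a (2 * k + 1) * z ^ (2 * k + 1)\<bar>)"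
      using summable_reindex[of "\<lambda>n. \<bar>a n * z ^ n\<bar>" "\<lambda>k. 2 * k + 1"] by (simp add: o_def inj_on_def)
    from summable_mult[OF this, of "2 * \<bar>z\<bar>"] show ?thesis by (simp add: abs_mult algebra_simps)
  qed
  define w where "w k = integral {0..pi} (\<lambda>\<theta>. cos \<theta> ^ (2 * k + 2))" for k
  define b where "b n = (case n of 0 \<Rightarrow> 0 | Suc k \<Rightarrow> 2 * a (2 * k + 1) * 2 ^ (k + 1) * w k / (2 * pi))" for n
  have w: "0 \<le> w k" "w k \<le> pi" for k
  proof -
    have int: "(\<lambda>\<theta>. cos \<theta> ^ (2 * k + 2)) integrable_on {0..pi}"
      by (intro integrable_continuous_interval continuous_intros)
    show "0 \<le> w k" unfolding w_def by (intro integral_nonneg int zero_le_even_power) simp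
    have "cos \<theta> ^ (2 * k + 2) \<le> 1" for \<theta> :: real
    proof -
      have "\<bar>cos \<theta>\<bar> ^ (2 * k + 2) \<le> 1" by (intro power_le_one) auto
      thus ?thesis by (simp add: power_even_abs)
    qed
    hence "w k \<le> integral {0..pi} (\<lambda>_. 1)"
      unfolding w_def by (intro integral_le int) auto
    thus "w k \<le> pi" by simp
  qed
  have bS: "b (Suc k) * e ^ Suc k = 2 * a (2 * k + 1) * (2 * e) ^ (k + 1) * w k / (2 * pi)" for k e
    by (simp add: b_def power_mult_distrib)
  have b_summable: "summable (\<lambda>k. b k * e ^ k)" if e: "\<bar>e\<bar> < R\<^sup>2 / 2" for e
  proof -
    define s where "s = sqrt (2 * \<bar>e\<bar>)"
    have s2: "s\<^sup>2 = 2 * \<bar>e\<bar>" "0 \<le> s" by (simp_all add: s_def)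
    have "s < R" unfolding s_def using e R by (intro real_less_lsqrt) auto
    have s_pow: "s ^ (2 * k + 2) = (2 * \<bar>e\<bar>) ^ (k + 1)" for k
      using power_mult[of s 2 "k + 1"] s2 by simp
    have "summable (\<lambda>k. b (Suc k) * e ^ Suc k)"
    proof (rule summable_comparison_test'[OF abs_summable[of s]])
      show "\<bar>s\<bar> < R" using \<open>s < R\<close> s2 by simp
      show "norm (b (Suc k) * e ^ Suc k) \<le> \<bar>2 * a (2 * k + 1) * s ^ (2 * k + 2)\<bar>" for k
      proof -
        have "norm (b (Suc k) * e ^ Suc k) = \<bar>2 * a (2 * k + 1) * s ^ (2 * k + 2)\<bar> * (w k / (2 * pi))"
          unfolding bS s_pow using w[of k] by (simp add: abs_mult power_abs)
        also have "\<dots> \<le> \<bar>2 * a (2 * k + 1) * s ^ (2 * k + 2)\<bar> * 1"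
          using w[of k] by (intro mult_left_mono) auto
        finally show ?thesis by simp
      qed
    qed
    thus ?thesis by (rule summable_Suc_iff[THEN iffD1])
  qed
  have value_sums: "unit_action \<rho> = (\<Sum>k. b k * (\<rho>\<^sup>2 / 2) ^ k)" if "0 \<le> \<rho>" "\<rho>\<^sup>2 / 2 < R\<^sup>2 / 2" for \<rho>
  proof -
    have "\<rho> < R" using that R by (simp add: power_less_imp_less_base)
    define f where "f k \<theta> = 2 * a (2 * k + 1) * (\<rho> * cos \<theta>) ^ (2 * k + 2)" for k \<theta>
    have le: "\<bar>\<rho> * cos \<theta>\<bar> \<le> \<rho>" for \<theta>
      using that(1) by (simp add: abs_mult mult_left_le)
    have int_sums: "(\<lambda>k. integral {0..pi} (f k)) sums
       integral {0..pi} (\<lambda>\<theta>. \<rho> * cos \<theta> * (radius (\<rho> * cos \<theta>) - radius (- (\<rho> * cos \<theta>))))"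
    proof (rule integral_sums)
      show "(\<lambda>k. f k \<theta>) sums (\<rho> * cos \<theta> * (radius (\<rho> * cos \<theta>) - radius (- (\<rho> * cos \<theta>))))" for \<theta>
        unfolding f_def using le[of \<theta>] \<open>\<rho> < R\<close> by (intro odd_sums) auto
      show "continuous_on {0..pi} (f k)" for k
        unfolding f_def by (intro continuous_intros)
      show "summable (\<lambda>k. \<bar>2 * a (2 * k + 1) * \<rho> ^ (2 * k + 2)\<bar>)"
        using \<open>\<rho> < R\<close> that(1) by (intro abs_summable) auto
      show "\<bar>f k \<theta>\<bar> \<le> \<bar>2 * a (2 * k + 1) * \<rho> ^ (2 * k + 2)\<bar>" for k \<theta>
      proof -
        have "\<bar>\<rho> * cos \<theta>\<bar> ^ (2 * k + 2) \<le> \<rho> ^ (2 * k + 2)" by (intro power_mono le) auto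
        thus ?thesis unfolding f_def using that(1)
          by (simp only: abs_mult power_abs abs_of_nonneg[of \<rho>] mult_left_mono abs_ge_zero mult_nonneg_nonneg)
      qed
    qed
    have coeff: "integral {0..pi} (f k) / (2 * pi) = b (Suc k) * (\<rho>\<^sup>2 / 2) ^ Suc k" for k
    proof -
      have "f k = (\<lambda>\<theta>. (2 * a (2 * k + 1) * (\<rho>\<^sup>2) ^ (k + 1)) * cos \<theta> ^ (2 * k + 2))"
        using power_mult[of \<rho> 2 "k + 1"] by (auto simp: f_def power_mult_distrib)
      hence "integral {0..pi} (f k) = (2 * a (2 * k + 1) * (\<rho>\<^sup>2) ^ (k + 1)) * w k"
        by (simp add: w_def)
      thus ?thesis unfolding bS by simp
    qed
    have "(\<lambda>k. b (Suc k) * (\<rho>\<^sup>2 / 2) ^ Suc k) sums unit_action \<rho>"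
      using sums_divide[OF int_sums, of "2 * pi"] unfolding coeff unit_action_def .
    hence "(\<lambda>k. b k * (\<rho>\<^sup>2 / 2) ^ k) sums (unit_action \<rho> + b 0 * (\<rho>\<^sup>2 / 2) ^ 0)"
      by (subst (asm) sums_Suc_iff) simp
    thus ?thesis by (simp add: sums_iff b_def)
  qed
  have w01: "w 0 = pi / 2" "w 1 = 3 * pi / 8"
    using integral_cos_squared integral_cos_fourth by (simp_all add: w_def flip: power2_eq_square)
  have "b (Suc 0) = a 1"
    unfolding b_def nat.case w01 by simp
  hence b1: "b 1 = a 1" by simp
  have "b (Suc 1) = 3 / 2 * a 3"
    unfolding b_def nat.case w01 by (simp add: numeral_3_eq_3)
  hence "b 2 = 3 / 2 * a 3" by (simp only: numeral_2_eq_2 One_nat_def)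
  hence "2 * b 2 = 11 / 12 * b 1" using a(3) b1 by simp
  thus ?thesis
    using that[of "R\<^sup>2 / 2" b] R b_summable value_sums b1 a(2) by (simp add: b_def)
qed

text \<open>
  \<open>B k\<close> is the \<open>k\<close>-th derivative of the action as a function of the energy, and \<open>\<beta>\<close> its inverse function,
  defined on an interval around \<open>0\<close>. The interval is so small that the inequalities between \<open>B 0\<close>,
  \<open>B 1\<close> and \<open>B 2\<close>, which hold at \<open>0\<close>, persist. The last clause concerns all \<open>\<rho>\<close>, not only small ones, since the action
  determines the energy globally.
\<close>

lemma unit_action_inverse:
  obtains B :: "nat \<Rightarrow> real \<Rightarrow> real" and \<beta> l u \<epsilon> where
    "0 < \<epsilon>"
    "\<And>t. t \<in> {l<..<u} \<Longrightarrow> (\<beta> has_real_derivative 1 / B 1 (\<beta> t)) (at t)"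
    "\<And>t k. t \<in> {l<..<u} \<Longrightarrow> (B k has_real_derivative B (k + 1) (\<beta> t)) (at (\<beta> t))"
    "\<And>t. t \<in> {l<..<u} \<Longrightarrow> B 0 (\<beta> t) = t"
    "\<And>t. t \<in> {l<..<u} \<Longrightarrow> 0 < B 1 (\<beta> t)"
    "\<And>t. t \<in> {l<..<u} \<Longrightarrow> B 0 (\<beta> t) \<noteq> B 1 (\<beta> t)"
    "\<And>t. t \<in> {l<..<u} \<Longrightarrow> B 1 (\<beta> t) \<noteq> B 2 (\<beta> t)"
    "\<And>\<rho>. 0 \<le> \<rho> \<Longrightarrow> \<rho>\<^sup>2 / 2 < \<epsilon> \<Longrightarrow> unit_action \<rho> \<in> {l<..<u}"
    "\<And>\<rho>. 0 \<le> \<rho> \<Longrightarrow> unit_action \<rho> \<in> {l<..<u} \<Longrightarrow> \<beta> (unit_action \<rho>) = \<rho>\<^sup>2 / 2"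
proof -
  have "\<exists>b \<epsilon>. 0 < \<epsilon> \<and> (\<forall>e. \<bar>e\<bar> < \<epsilon> \<longrightarrow> summable (\<lambda>k. b k * e ^ k)) \<and>
     (\<forall>\<rho>. 0 \<le> \<rho> \<longrightarrow> \<rho>\<^sup>2 / 2 < \<epsilon> \<longrightarrow> unit_action \<rho> = (\<Sum>k. b k * (\<rho>\<^sup>2 / 2) ^ k)) \<and>
     (b 0 :: real) = 0 \<and> 0 < b 1 \<and> 2 * b 2 = 11 / 12 * b 1"
    by (rule unit_action_power_series) blast
  then obtain b :: "nat \<Rightarrow> real" and \<epsilon>0 where "0 < \<epsilon>0"
    and b_sum: "\<And>e. \<bar>e\<bar> < \<epsilon>0 \<Longrightarrow> summable (\<lambda>k. b k * e ^ k)"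
    and b_val: "\<And>\<rho>. 0 \<le> \<rho> \<Longrightarrow> \<rho>\<^sup>2 / 2 < \<epsilon>0 \<Longrightarrow> unit_action \<rho> = (\<Sum>k. b k * (\<rho>\<^sup>2 / 2) ^ k)"
    and b012: "b 0 = 0" "0 < b 1" "2 * b 2 = 11 / 12 * b 1"
    by blast
  define B where "B k e = (\<Sum>n. (diffs ^^ k) b n * e ^ n)" for k e
  have summ: "summable (\<lambda>n. (diffs ^^ k) b n * e ^ n)" if "norm e < \<epsilon>0" for k e
    using that
  proof (induction k arbitrary: e)
    case 0 thus ?case using b_sum by simp
  next
    case (Suc k)
    show ?case
      using termdiff_converges[of e \<epsilon>0 "(diffs ^^ k) b", OF Suc.prems Suc.IH] by simp
  qed
  have B_deriv: "(B k has_real_derivative B (k + 1) e) (at e)" if "\<bar>e\<bar> < \<epsilon>0" for k e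
    using termdiffs_strong'[of \<epsilon>0 "(diffs ^^ k) b" e] summ that unfolding B_def by simp
  have B_cont: "isCont (B k) e" if "\<bar>e\<bar> < \<epsilon>0" for k e
    using B_deriv[OF that] by (rule DERIV_isCont)
  have B_at_0: "B 0 0 = 0" "B 1 0 = b 1" "B 2 0 = 11 / 12 * b 1"
    using b012 by (simp_all add: B_def diffs_def numeral_2_eq_2 del: of_nat_Suc)
  have "\<forall>\<^sub>F e in nhds 0. 0 < B 1 e \<and> 0 < B 1 e - B 0 e \<and> 0 < B 1 e - B 2 e"
  proof (intro eventually_conj)
    have ev: "\<forall>\<^sub>F e in nhds 0. 0 < f e" if "isCont f 0" "0 < f 0" for f :: "real \<Rightarrow> real"
      using that by (intro order_tendstoD(1)[of f "f 0"]) (auto simp: isCont_def tendsto_at_iff_tendsto_nhds)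
    have cont: "isCont (B k) 0" for k using B_cont[of 0] \<open>0 < \<epsilon>0\<close> by simp
    have pos: "0 < B 1 0" "0 < B 1 0 - B 0 0" "0 < B 1 0 - B 2 0"
      using b012(2) unfolding B_at_0 by simp_all
    show "\<forall>\<^sub>F e in nhds 0. 0 < B 1 e"
      by (rule ev[OF cont pos(1)])
    show "\<forall>\<^sub>F e in nhds 0. 0 < B 1 e - B 0 e"
      by (rule ev[OF continuous_diff[OF cont cont] pos(2)])
    show "\<forall>\<^sub>F e in nhds 0. 0 < B 1 e - B 2 e"
      by (rule ev[OF continuous_diff[OF cont cont] pos(3)])
  qed
  then obtain d where d: "0 < d"
    "\<And>e. dist e 0 < d \<Longrightarrow> 0 < B 1 e \<and> 0 < B 1 e - B 0 e \<and> 0 < B 1 e - B 2 e"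
    unfolding eventually_nhds_metric by blast
  define \<epsilon> where "\<epsilon> = min \<epsilon>0 d / 2"
  have \<epsilon>: "0 < \<epsilon>" "\<And>e. \<bar>e\<bar> \<le> \<epsilon> \<Longrightarrow> \<bar>e\<bar> < \<epsilon>0"
    "\<And>e. \<bar>e\<bar> \<le> \<epsilon> \<Longrightarrow> 0 < B 1 e \<and> B 0 e \<noteq> B 1 e \<and> B 1 e \<noteq> B 2 e"
  proof -
    show "0 < \<epsilon>" "\<And>e. \<bar>e\<bar> \<le> \<epsilon> \<Longrightarrow> \<bar>e\<bar> < \<epsilon>0" using d(1) \<open>0 < \<epsilon>0\<close> by (auto simp: \<epsilon>_def)
    fix e assume "\<bar>e\<bar> \<le> \<epsilon>"
    hence "dist e 0 < d" using d(1) \<open>0 < \<epsilon>0\<close> by (simp add: \<epsilon>_def)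
    from d(2)[OF this] show "0 < B 1 e \<and> B 0 e \<noteq> B 1 e \<and> B 1 e \<noteq> B 2 e" by linarith
  qed
  have mono: "B 0 e < B 0 e'" if "-\<epsilon> \<le> e" "e < e'" "e' \<le> \<epsilon>" for e e'
  proof (rule DERIV_pos_imp_increasing[OF \<open>e < e'\<close>])
    fix x assume "e \<le> x" "x \<le> e'"
    hence "\<bar>x\<bar> \<le> \<epsilon>" using that by auto
    thus "\<exists>y. (B 0 has_real_derivative y) (at x) \<and> 0 < y"
      using B_deriv[of x 0] \<epsilon> by auto
  qed
  define \<beta> where "\<beta> = the_inv_into {-\<epsilon>..\<epsilon>} (B 0)"
  have inj: "inj_on (B 0) {-\<epsilon>..\<epsilon>}"
    by (rule linorder_inj_onI) (use mono in \<open>force+\<close>)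
  have \<beta>_B: "\<beta> (B 0 e) = e" if "\<bar>e\<bar> \<le> \<epsilon>" for e
    unfolding \<beta>_def using inj that by (intro the_inv_into_f_f) auto
  define l u where "l = B 0 (-\<epsilon>)" and "u = B 0 \<epsilon>"
  have \<beta>: "\<bar>\<beta> t\<bar> < \<epsilon> \<and> B 0 (\<beta> t) = t" if t: "t \<in> {l<..<u}" for t
  proof -
    obtain e where e: "-\<epsilon> \<le> e" "e \<le> \<epsilon>" "B 0 e = t"
      using IVT[of "B 0" "-\<epsilon>" t \<epsilon>] t \<epsilon> B_cont by (force simp: l_def u_def)
    hence "\<beta> t = e" using \<beta>_B[of e] by auto
    moreover have "e \<noteq> \<epsilon>" "e \<noteq> -\<epsilon>" using e(3) t by (auto simp: l_def u_def)
    ultimately show ?thesis using e by auto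
  qed
  have \<beta>_deriv: "(\<beta> has_real_derivative 1 / B 1 (\<beta> t)) (at t)" if t: "t \<in> {l<..<u}" for t
  proof -
    define d' where "d' = \<epsilon> - \<bar>\<beta> t\<bar>"
    have "isCont \<beta> (B 0 (\<beta> t))"
    proof (rule isCont_inverse_function[where d = d' and f = "B 0" and x = "\<beta> t"])
      show "0 < d'" using \<beta>[OF t] by (simp add: d'_def)
      fix z assume "\<bar>z - \<beta> t\<bar> \<le> d'"
      hence z: "\<bar>z\<bar> \<le> \<epsilon>" by (simp add: d'_def)
      show "\<beta> (B 0 z) = z" using \<beta>_B[OF z] .
      show "isCont (B 0) z" using B_cont \<epsilon>(2)[OF z] by blast
    qed
    hence cont: "isCont \<beta> t" using \<beta>[OF t] by simp
    have "\<bar>\<beta> t\<bar> \<le> \<epsilon>" using \<beta>[OF t] by simp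
    hence "(B 0 has_real_derivative B 1 (\<beta> t)) (at (\<beta> t))" "B 1 (\<beta> t) \<noteq> 0"
      using B_deriv[of "\<beta> t" 0] \<epsilon>(2,3)[of "\<beta> t"] by auto
    hence "(\<beta> has_real_derivative inverse (B 1 (\<beta> t))) (at t)"
      using t by (intro DERIV_inverse_function[where a = l and b = u and f = "B 0"] cont)
        (auto simp: \<beta>)
    thus ?thesis by (simp add: divide_inverse)
  qed
  have small: "unit_action \<rho> = B 0 (\<rho>\<^sup>2 / 2)" if "0 \<le> \<rho>" "\<rho>\<^sup>2 / 2 \<le> \<epsilon>" for \<rho>
    using b_val[of \<rho>] \<epsilon>(2)[of "\<rho>\<^sup>2 / 2"] that by (simp add: B_def)
  show ?thesis
  proof (rule that[of \<epsilon> l u \<beta> B])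
    fix \<rho> :: real assume \<rho>: "0 \<le> \<rho>"
    have neg: "-\<epsilon> < \<rho>\<^sup>2 / 2" using \<epsilon>(1) zero_le_power2[of \<rho>] by linarith
    show "unit_action \<rho> \<in> {l<..<u}" if "\<rho>\<^sup>2 / 2 < \<epsilon>"
      using small[of \<rho>] mono[of "-\<epsilon>" "\<rho>\<^sup>2 / 2"] mono[of "\<rho>\<^sup>2 / 2" \<epsilon>] \<rho> that neg
      by (simp add: l_def u_def)
    show "\<beta> (unit_action \<rho>) = \<rho>\<^sup>2 / 2" if "unit_action \<rho> \<in> {l<..<u}"
    proof -
      have "\<rho>\<^sup>2 / 2 < \<epsilon>"
      proof (rule ccontr)
        assume "\<not> \<rho>\<^sup>2 / 2 < \<epsilon>"
        hence "sqrt (2 * \<epsilon>) \<le> \<rho>" using \<rho> by (intro real_le_lsqrt) auto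
        hence "unit_action (sqrt (2 * \<epsilon>)) \<le> unit_action \<rho>" using \<epsilon>(1) by (intro unit_action_mono) auto
        moreover have "unit_action (sqrt (2 * \<epsilon>)) = u" using small[of "sqrt (2 * \<epsilon>)"] \<epsilon>(1) by (simp add: u_def)
        ultimately show False using that by simp
      qed
      thus ?thesis using small[of \<rho>] \<rho> \<beta>_B[of "\<rho>\<^sup>2 / 2"] by simp
    qed
  next
    fix t assume t: "t \<in> {l<..<u}"
    hence \<beta>t: "\<bar>\<beta> t\<bar> \<le> \<epsilon>" using \<beta> by force
    show "0 < B 1 (\<beta> t)" "B 0 (\<beta> t) \<noteq> B 1 (\<beta> t)" "B 1 (\<beta> t) \<noteq> B 2 (\<beta> t)" using \<epsilon>(3)[OF \<beta>t] by auto
    show "(B k has_real_derivative B (k + 1) (\<beta> t)) (at (\<beta> t))" for k using B_deriv \<epsilon>(2)[OF \<beta>t] by blast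
  qed (use \<epsilon> \<beta> \<beta>_deriv in auto)
qed

section \<open>Non-degeneracy of the energy as a function of the actions\<close>

definition flat_part :: "real^('n::finite option) \<Rightarrow> real^'n" where
  "flat_part C = (\<chi> i. C $ Some i)"

definition action_vector :: "real \<Rightarrow> real^'n \<Rightarrow> real^('n::finite option)" where
  "action_vector A P = (\<chi> j. case j of None \<Rightarrow> A | Some i \<Rightarrow> P $ i)"

lemma action_vector_nth [simp]: "action_vector A P $ None = A" "action_vector A P $ Some i = P $ i"
  by (simp_all add: action_vector_def)

lemma flat_part_action_vector [simp]: "flat_part (action_vector A P) = P"
  by (simp add: flat_part_def vec_eq_iff)

lemma vec_option_eq_iff: "(x :: real^('n::finite option)) = y \<longleftrightarrow> x $ None = y $ None \<and> flat_part x = flat_part y"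
  by (auto simp: vec_eq_iff flat_part_def split_option_all)

lemma linear_flat_part: "linear flat_part"
  by (intro linearI) (auto simp: flat_part_def vec_eq_iff)

lemma inner_vec_option: "x \<bullet> y = x $ None * y $ None + flat_part x \<bullet> flat_part y"
  for x y :: "real^('n::finite option)"
  by (simp add: inner_vec_def flat_part_def UNIV_option_conv sum.reindex)

lemma det_nonzero_if_kernel_trivial:
  fixes A :: "real^'m^'m"
  assumes "\<And>v. A *v v = 0 \<Longrightarrow> v = 0"
  shows "det A \<noteq> 0"
  using assms by (metis invertible_det_nz invertible_left_inverse matrix_left_invertible_ker)

lemma bordered_mult:
  fixes D :: "real^'m^'m"
  shows "(bordered D \<omega> *v z) $ Some i = (D *v flat_part z) $ i + z $ None * \<omega> $ i"
    "(bordered D \<omega> *v z) $ None = \<omega> \<bullet> flat_part z"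
  by (simp_all add: bordered_def matrix_vector_mult_def inner_vec_def flat_part_def UNIV_option_conv sum.reindex)

text \<open>
  Here \<open>K\<close> is the inverse matrix of the metric, so that \<open>norm2\<close> below is \<open>|W|\<^sup>2\<close>, and \<open>\<beta>\<close> is the energy as a
  function of the action on \<open>|W| = 1\<close>. The functions \<open>p\<close> and \<open>q\<close> are its first two derivatives. The last two
  assumptions say that neither the derivative of \<open>exp (\<beta> t) / t\<close> nor the second derivative of \<open>exp (\<beta> t)\<close>
  vanishes (for \<open>t \<noteq> 0\<close> in the first case).
\<close>

locale flat_energy =
  fixes K :: "real^'n^'n" and \<beta> p q :: "real \<Rightarrow> real" and I :: "real set"
  assumes K_sym: "transpose K = K"
    and K_pos: "\<And>v. v \<noteq> 0 \<Longrightarrow> 0 < v \<bullet> (K *v v)"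
    and I_open: "open I"
    and \<beta>_deriv: "\<And>t. t \<in> I \<Longrightarrow> (\<beta> has_real_derivative p t) (at t)"
    and p_deriv: "\<And>t. t \<in> I \<Longrightarrow> (p has_real_derivative q t) (at t)"
    and p_small: "\<And>t. t \<in> I \<Longrightarrow> t * p t \<noteq> 1"
    and q_nz: "\<And>t. t \<in> I \<Longrightarrow> q t + (p t)\<^sup>2 \<noteq> 0"
begin

definition norm2 :: "real^('n option) \<Rightarrow> real" where
  "norm2 C = flat_part C \<bullet> (K *v flat_part C)"

definition inv_norm :: "real^('n option) \<Rightarrow> real" where
  "inv_norm C = 1 / sqrt (norm2 C)"

text \<open>
  The scaling-invariant ratio \<open>A/|W|\<close>, on which alone the energy depends once \<open>ln |W|\<close> is split off.
\<close>

definition slope :: "real^('n option) \<Rightarrow> real" where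
  "slope C = C $ None * inv_norm C"

text \<open>
  Half of the differential of \<open>norm2\<close> at \<open>C\<close>, applied to \<open>v\<close>.
\<close>

definition pairing :: "real^('n option) \<Rightarrow> real^('n option) \<Rightarrow> real" where
  "pairing C v = (K *v flat_part C) \<bullet> flat_part v"

definition slope' :: "real^('n option) \<Rightarrow> real^('n option) \<Rightarrow> real" where
  "slope' C v = v $ None * inv_norm C - slope C * (inv_norm C)\<^sup>2 * pairing C v"

definition energy :: "real^('n option) \<Rightarrow> real" where
  "energy C = 1 / 2 + ln (norm2 C) / 2 + \<beta> (slope C)"

text \<open>
  An open set of action vectors; those with negative \<open>A\<close>, beyond the equilibria, belong to no point of phase
  space.
\<close>

definition regular :: "(real^('n option)) set" where
  "regular = {C. flat_part C \<noteq> 0 \<and> slope C \<in> I}"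

definition gradient :: "real^('n option) \<Rightarrow> real^('n option)" where
  "gradient C = action_vector (p (slope C) * inv_norm C)
     (((1 - slope C * p (slope C)) * (inv_norm C)\<^sup>2) *\<^sub>R (K *v flat_part C))"

lemma K_inner_commute: "x \<bullet> (K *v y) = (K *v x) \<bullet> y"
  by (metis dot_lmul_matrix K_sym vector_transpose_matrix)

lemma norm2_pos: "flat_part C \<noteq> 0 \<Longrightarrow> 0 < norm2 C"
  unfolding norm2_def by (rule K_pos)

lemma inv_norm_pos: "flat_part C \<noteq> 0 \<Longrightarrow> 0 < inv_norm C"
  unfolding inv_norm_def by (simp add: norm2_pos)

lemma inv_norm_square: "flat_part C \<noteq> 0 \<Longrightarrow> (inv_norm C)\<^sup>2 * norm2 C = 1"
  using norm2_pos[of C] by (simp add: inv_norm_def power_divide)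

lemma flat_part_has_derivative [derivative_intros]: "(flat_part has_derivative flat_part) (at C within S)"
  by (simp add: linear_flat_part linear_imp_has_derivative)

lemma norm2_has_derivative: "(norm2 has_derivative (\<lambda>v. 2 * pairing C v)) (at C)"
proof -
  have "((\<lambda>C. K *v flat_part C) has_derivative (\<lambda>v. K *v flat_part v)) (at C)"
    by (intro linear_imp_has_derivative linear_compose[OF linear_flat_part, of "(*v) K", unfolded o_def]) simp
  from has_derivative_inner[OF flat_part_has_derivative this]
  have "(norm2 has_derivative (\<lambda>v. flat_part C \<bullet> (K *v flat_part v) + flat_part v \<bullet> (K *v flat_part C))) (at C)"
    by (simp add: norm2_def[abs_def])
  thus ?thesis
    by (simp add: pairing_def K_inner_commute[of "flat_part C"] inner_commute[of _ "K *v flat_part C"])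
qed

lemma inv_norm_has_derivative:
  assumes "flat_part C \<noteq> 0"
  shows "(inv_norm has_derivative (\<lambda>v. - (inv_norm C ^ 3) * pairing C v)) (at C)"
proof -
  have n: "0 < norm2 C" using norm2_pos[OF assms] .
  have "((\<lambda>x. 1 / sqrt x) has_real_derivative - ((1 / sqrt (norm2 C)) ^ 3) / 2) (at (norm2 C))"
    using n by (auto intro!: derivative_eq_intros simp: power3_eq_cube field_simps)
  from has_derivative_compose[OF norm2_has_derivative this[unfolded has_field_derivative_def]]
  show ?thesis by (simp add: inv_norm_def[abs_def] mult.assoc)
qed

lemma ln_norm2_has_derivative:
  assumes "flat_part C \<noteq> 0"
  shows "((\<lambda>C. ln (norm2 C) / 2) has_derivative (\<lambda>v. (inv_norm C)\<^sup>2 * pairing C v)) (at C)"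
proof -
  have n: "0 < norm2 C" using norm2_pos[OF assms] .
  have "((\<lambda>x. ln x / 2) has_real_derivative 1 / norm2 C / 2) (at (norm2 C))"
    using n by (auto intro!: derivative_eq_intros)
  from has_derivative_compose[OF norm2_has_derivative this[unfolded has_field_derivative_def]]
  show ?thesis using n by (simp add: inv_norm_def power_divide)
qed

lemma slope_has_derivative:
  assumes "flat_part C \<noteq> 0"
  shows "(slope has_derivative slope' C) (at C)"
proof -
  have "((\<lambda>C. C $ None) has_derivative (\<lambda>v. v $ None)) (at C)"
    by (intro linear_imp_has_derivative) (auto intro: linearI)
  from has_derivative_mult[OF this inv_norm_has_derivative[OF assms]] show ?thesis
    unfolding slope_def[abs_def] slope'_def
    by (rule has_derivative_eq_rhs) (auto simp: power2_eq_square power3_eq_cube algebra_simps)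
qed

lemma open_regular: "open regular"
proof -
  have cont: "continuous_on {C. flat_part C \<noteq> 0} slope"
    by (intro continuous_at_imp_continuous_on) (auto intro: has_derivative_continuous slope_has_derivative)
  have "continuous_on UNIV flat_part"
    by (intro linear_continuous_on linear_linear[THEN iffD2] linear_flat_part)
  hence "open (flat_part -` (- {0::real^'n}))"
    by (intro open_vimage) auto
  hence "open {C :: real^('n option). flat_part C \<noteq> 0}" by (simp add: vimage_def)
  with cont I_open have "open (slope -` I \<inter> {C. flat_part C \<noteq> 0})"
    by (simp add: continuous_on_open_vimage)
  thus ?thesis by (simp add: regular_def vimage_def Int_def conj_commute)
qed

lemma DERIV_of_slope:
  assumes "C \<in> regular" "(f has_real_derivative f') (at (slope C))"
  shows "((\<lambda>C. f (slope C)) has_derivative (\<lambda>v. f' * slope' C v)) (at C)"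
  using has_derivative_compose[OF slope_has_derivative assms(2)[unfolded has_field_derivative_def]] assms(1)
  by (auto simp: regular_def)

lemma energy_has_derivative:
  assumes "C \<in> regular"
  shows "(energy has_derivative (\<lambda>v. gradient C \<bullet> v)) (at C)"
proof -
  have C: "flat_part C \<noteq> 0" "slope C \<in> I" using assms by (auto simp: regular_def)
  have "(energy has_derivative (\<lambda>v. (inv_norm C)\<^sup>2 * pairing C v + p (slope C) * slope' C v)) (at C)"
    unfolding energy_def[abs_def]
    using has_derivative_add[OF has_derivative_add[OF has_derivative_const ln_norm2_has_derivative[OF C(1)]]
        DERIV_of_slope[OF assms \<beta>_deriv[OF C(2)]], of "1 / 2"] by simp
  moreover have "(inv_norm C)\<^sup>2 * pairing C v + p (slope C) * slope' C v = gradient C \<bullet> v" for v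
    unfolding gradient_def inner_vec_option by (simp add: slope'_def pairing_def algebra_simps)
  ultimately show ?thesis by simp
qed

lemma frequency_energy:
  assumes "C \<in> regular"
  shows "frequency energy C = gradient C"
  using frechet_derivative_at[OF energy_has_derivative[OF assms], symmetric]
  by (simp add: frequency_def vec_eq_iff inner_axis)

definition gradient' :: "real^('n option) \<Rightarrow> real^('n option) \<Rightarrow> real^('n option)" where
  "gradient' C v = action_vector
     (q (slope C) * slope' C v * inv_norm C - p (slope C) * inv_norm C ^ 3 * pairing C v)
     ((- (p (slope C) + slope C * q (slope C)) * slope' C v * (inv_norm C)\<^sup>2
        - 2 * (1 - slope C * p (slope C)) * inv_norm C ^ 4 * pairing C v) *\<^sub>R (K *v flat_part C)
      + ((1 - slope C * p (slope C)) * (inv_norm C)\<^sup>2) *\<^sub>R (K *v flat_part v))"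

lemma gradient_has_derivative:
  assumes "C \<in> regular"
  shows "(gradient has_derivative gradient' C) (at C)"
proof -
  have C: "flat_part C \<noteq> 0" "slope C \<in> I" using assms by (auto simp: regular_def)
  note rho = inv_norm_has_derivative[OF C(1)] and slope = slope_has_derivative[OF C(1)]
    and p = DERIV_of_slope[OF assms p_deriv[OF C(2)]]
  have K: "((\<lambda>C. (K *v flat_part C) $ i) has_derivative (\<lambda>v. (K *v flat_part v) $ i)) (at C)" for i
    by (intro linear_imp_has_derivative linearI)
       (simp_all add: linear_add[OF linear_flat_part] linear_cmul[OF linear_flat_part]
          matrix_vector_right_distrib matrix_vector_mult_scaleR)
  have "((\<lambda>C. gradient C $ j) has_derivative (\<lambda>v. gradient' C v $ j)) (at C)" for j
  proof (cases j)
    case None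
    have "((\<lambda>C. p (slope C) * inv_norm C) has_derivative (\<lambda>v. p (slope C) * (- (inv_norm C ^ 3) * pairing C v)
             + q (slope C) * slope' C v * inv_norm C)) (at C)"
      by (rule has_derivative_mult[OF p rho])
    thus ?thesis unfolding None gradient_def gradient'_def by (simp add: algebra_simps)
  next
    case (Some i)
    have "((\<lambda>C. (1 - slope C * p (slope C)) * (inv_norm C * inv_norm C) * (K *v flat_part C) $ i)
       has_derivative (\<lambda>v. (1 - slope C * p (slope C)) * (inv_norm C * inv_norm C) * (K *v flat_part v) $ i
        + ((1 - slope C * p (slope C)) *
           (inv_norm C * (- (inv_norm C ^ 3) * pairing C v) + (- (inv_norm C ^ 3) * pairing C v) * inv_norm C)
           + (0 - (slope C * (q (slope C) * slope' C v) + slope' C v * p (slope C))) * (inv_norm C * inv_norm C))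
          * (K *v flat_part C) $ i)) (at C)"
      by (intro has_derivative_mult has_derivative_diff has_derivative_const K rho slope p)
    thus ?thesis unfolding Some gradient_def gradient'_def
      by (simp add: power2_eq_square)
         (erule has_derivative_eq_rhs, simp add: fun_eq_iff algebra_simps power2_eq_square power3_eq_cube power4_eq_xxxx)
  qed
  thus ?thesis
    by (subst has_derivative_componentwise_within) (auto simp: Basis_vec_def inner_axis)
qed

lemma d_frequency_energy:
  assumes "C \<in> regular"
  shows "d_frequency energy C *v v = gradient' C v"
proof -
  have "(frequency energy has_derivative gradient' C) (at C)"
    using frechet_derivative_cong_open(1)[OF open_regular assms frequency_energy gradient_has_derivative[OF assms]] .
  hence "frechet_derivative (frequency energy) (at C) = gradient' C" "linear (gradient' C)"
    by (auto dest: frechet_derivative_at has_derivative_linear)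
  thus ?thesis by (simp add: d_frequency_def jacobian_def matrix_works)
qed

text \<open>
  As \<open>exp energy\<close> is homogeneous of degree one, Euler's relation gives \<open>gradient C \<bullet> C = 1\<close> and
  \<open>gradient' C C = - gradient C\<close>. The claim is that this is the only way in which \<open>gradient' C v\<close> can be a
  multiple of the gradient. Both non-degeneracy conditions follow: \<open>\<tau> = 0\<close> forces \<open>v = 0\<close>, and so does
  \<open>gradient C \<bullet> v = 0\<close>.

  The momentum components of the equation show that the momentum part of \<open>v\<close> is parallel to that of \<open>C\<close>, as
  the Hessian acts on directions orthogonal to it as \<open>(1 - s p s) / |W|\<^sup>2\<close> times \<open>K\<close>. What remains is a linear system for
  two numbers, the change \<open>x\<close> of the slope and the defect \<open>\<mu> - \<tau>\<close>, with determinant \<open>q s + (p s)\<^sup>2\<close>.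
\<close>

lemma bordered_kernel:
  assumes C: "C \<in> regular" and ker: "gradient' C v + \<tau> *\<^sub>R gradient C = 0"
  shows "v = \<tau> *\<^sub>R C" and "gradient C \<bullet> v = \<tau>"
proof -
  have C': "flat_part C \<noteq> 0" "slope C \<in> I" using C by (auto simp: regular_def)
  define \<rho> s P x where "\<rho> = inv_norm C" "s = slope C" "P = p s" "x = slope' C v"
  \<comment> \<open>\<open>\<phi>\<close> is the factor of \<open>K *v flat_part C\<close> in the momentum part of the gradient, and \<open>d\<phi>\<close> its
     differential at \<open>C\<close>, applied to \<open>v\<close>.\<close>
  define \<phi> where "\<phi> = (1 - s * P) * \<rho>\<^sup>2"
  define d\<phi> where "d\<phi> = - (P + s * q s) * x * \<rho>\<^sup>2 - 2 * (1 - s * P) * \<rho> ^ 4 * pairing C v"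
  have \<rho>: "\<rho> > 0" using inv_norm_pos[OF C'(1)] by (simp add: \<rho>_s_P_x_def)
  have "s * P \<noteq> 1" using p_small[OF C'(2)] by (simp add: \<rho>_s_P_x_def)
  hence \<phi>: "\<phi> \<noteq> 0" using \<rho> by (simp add: \<phi>_def)
  have "flat_part (gradient' C v + \<tau> *\<^sub>R gradient C) = 0" using ker by (simp add: flat_part_def vec_eq_iff)
  hence "d\<phi> *\<^sub>R (K *v flat_part C) + \<phi> *\<^sub>R (K *v flat_part v) + \<tau> *\<^sub>R (\<phi> *\<^sub>R (K *v flat_part C)) = 0"
    by (simp add: linear_add[OF linear_flat_part] linear_cmul[OF linear_flat_part] gradient_def gradient'_def
        d\<phi>_def \<phi>_def \<rho>_s_P_x_def)
  hence "K *v (d\<phi> *\<^sub>R flat_part C + \<phi> *\<^sub>R flat_part v + (\<tau> * \<phi>) *\<^sub>R flat_part C) = 0"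
    by (simp add: matrix_vector_right_distrib matrix_vector_mult_scaleR)
  hence "d\<phi> *\<^sub>R flat_part C + \<phi> *\<^sub>R flat_part v + (\<tau> * \<phi>) *\<^sub>R flat_part C = 0"
    using K_pos by (metis inner_zero_right less_irrefl)
  hence par: "\<phi> *\<^sub>R flat_part v = (- d\<phi> - \<tau> * \<phi>) *\<^sub>R flat_part C"
    by (simp add: scaleR_left_diff_distrib eq_diff_eq eq_neg_iff_add_eq_0 ac_simps)
  define \<mu> where "\<mu> = (- d\<phi> - \<tau> * \<phi>) / \<phi>"
  have "flat_part v = (1 / \<phi>) *\<^sub>R (\<phi> *\<^sub>R flat_part v)" using \<phi> by simp
  also have "\<dots> = \<mu> *\<^sub>R flat_part C" unfolding par by (simp add: \<mu>_def)
  finally have v: "flat_part v = \<mu> *\<^sub>R flat_part C" .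
  have pairing: "\<rho>\<^sup>2 * pairing C v = \<mu>"
    using inv_norm_square[OF C'(1)] by (simp add: pairing_def v norm2_def inner_commute \<rho>_s_P_x_def mult.left_commute)
  have x: "x = v $ None * \<rho> - s * \<mu>"
    using pairing by (simp add: slope'_def \<rho>_s_P_x_def)
  have "\<mu> * \<phi> = - d\<phi> - \<tau> * \<phi>" using \<phi> by (simp add: \<mu>_def)
  also have "d\<phi> = - (P + s * q s) * x * \<rho>\<^sup>2 - 2 * (1 - s * P) * \<rho>\<^sup>2 * (\<rho>\<^sup>2 * pairing C v)"
    by (simp add: d\<phi>_def power2_eq_square power4_eq_xxxx)
  also have "\<dots> = - (P + s * q s) * x * \<rho>\<^sup>2 - 2 * \<phi> * \<mu>"
    unfolding pairing by (simp add: \<phi>_def)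
  finally have "\<rho>\<^sup>2 * ((P + s * q s) * x + (1 - s * P) * (\<mu> - \<tau>)) = 0"
    by (simp add: \<phi>_def algebra_simps)
  hence e1: "(P + s * q s) * x + (1 - s * P) * (\<mu> - \<tau>) = 0" using \<rho> by simp
  have "(gradient' C v + \<tau> *\<^sub>R gradient C) $ None = 0" using ker by simp
  hence "q s * x * \<rho> - P * \<rho> * (\<rho>\<^sup>2 * pairing C v) + \<tau> * (P * \<rho>) = 0"
    by (simp add: gradient_def gradient'_def \<rho>_s_P_x_def power2_eq_square power3_eq_cube mult.assoc)
  hence "\<rho> * (q s * x - P * (\<mu> - \<tau>)) = 0" unfolding pairing by (simp add: algebra_simps)
  hence e2: "q s * x = P * (\<mu> - \<tau>)" using \<rho> by simp
  have "P * x + s * (q s * x) + (\<mu> - \<tau>) - s * (P * (\<mu> - \<tau>)) = 0"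
    using e1 by (simp add: algebra_simps)
  hence e3: "\<mu> - \<tau> = - (P * x)" unfolding e2 by simp
  have "(q s + P\<^sup>2) * x = 0" using e2 unfolding e3 by (simp add: algebra_simps power2_eq_square)
  hence "x = 0" using q_nz[OF C'(2)] by (simp add: \<rho>_s_P_x_def)
  hence \<mu>: "\<mu> = \<tau>" and vN: "v $ None * \<rho> = s * \<tau>" using e3 x by simp_all
  have "s = C $ None * \<rho>" by (simp add: slope_def \<rho>_s_P_x_def)
  hence "v $ None = \<tau> * C $ None" using vN \<rho> by simp
  thus "v = \<tau> *\<^sub>R C"
    using v \<mu> by (simp add: vec_option_eq_iff linear_cmul[OF linear_flat_part])
  have "gradient C \<bullet> v = P * \<rho> * v $ None + (1 - s * P) * (\<rho>\<^sup>2 * pairing C v)"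
    by (simp add: inner_vec_option gradient_def pairing_def \<rho>_s_P_x_def)
  also have "\<dots> = P * (v $ None * \<rho>) + (1 - s * P) * \<mu>" unfolding pairing by simp
  also have "\<dots> = \<tau>" unfolding vN \<mu> by (simp add: algebra_simps)
  finally show "gradient C \<bullet> v = \<tau>" .
qed

lemma energy_kolmogorov: "C \<in> regular \<Longrightarrow> kolmogorov_nondegenerate_at energy C"
  unfolding kolmogorov_nondegenerate_at_def
proof (rule det_nonzero_if_kernel_trivial)
  fix v assume C: "C \<in> regular" and "d_frequency energy C *v v = 0"
  hence "gradient' C v + 0 *\<^sub>R gradient C = 0" by (simp add: d_frequency_energy)
  from bordered_kernel(1)[OF C this] show "v = 0" by simp
qed

lemma energy_isoenergetic: "C \<in> regular \<Longrightarrow> isoenergetically_nondegenerate_at energy C"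
  unfolding isoenergetically_nondegenerate_at_def
proof (rule det_nonzero_if_kernel_trivial)
  fix z assume C: "C \<in> regular" and z: "bordered (d_frequency energy C) (frequency energy C) *v z = 0"
  have "gradient' C (flat_part z) + (z $ None) *\<^sub>R gradient C = 0"
  proof (subst vec_eq_iff, intro allI)
    fix i
    have "(bordered (d_frequency energy C) (frequency energy C) *v z) $ Some i = 0" using z by simp
    thus "(gradient' C (flat_part z) + (z $ None) *\<^sub>R gradient C) $ i = 0 $ i"
      by (simp add: bordered_mult d_frequency_energy[OF C] frequency_energy[OF C])
  qed
  note ker = bordered_kernel[OF C this]
  have "(bordered (d_frequency energy C) (frequency energy C) *v z) $ None = 0" using z by simp
  hence "z $ None = 0" using ker(2) by (simp add: bordered_mult frequency_energy[OF C])
  thus "z = 0" using ker(1) by (simp add: vec_option_eq_iff linear_0[OF linear_flat_part])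
qed

text \<open>
  \<open>\<beta>\<close> is an inverse function, so all its derivatives are polynomials in \<open>1 / B 1\<close> and the \<open>B k\<close>, composed with
  \<open>\<beta>\<close>. Together with the reciprocal norm, its logarithm and the linear functions they generate an algebra
  that is closed under partial derivatives.
\<close>

lemma smooth_energy:
  fixes B :: "nat \<Rightarrow> real \<Rightarrow> real"
  assumes B: "\<And>t k. t \<in> I \<Longrightarrow> (B k has_real_derivative B (k + 1) (\<beta> t)) (at (\<beta> t))"
    and p: "\<And>t. t \<in> I \<Longrightarrow> p t = 1 / B 1 (\<beta> t)" and B1: "\<And>t. t \<in> I \<Longrightarrow> B 1 (\<beta> t) \<noteq> 0"
  shows "smooth regular energy"
proof -
  define b where "b C = \<beta> (slope C)" for C
  define r where "r C = 1 / B 1 (b C)" for C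
  define G where "G = {f. linear f} \<union> {inv_norm, \<lambda>C. ln (norm2 C) / 2, b, r} \<union> range (\<lambda>k C. B k (b C))"
  let ?A = "function_algebra G"
  have linear: "f \<in> ?A" if "linear f" for f using that by (intro function_algebra.gen) (simp add: G_def)
  have gens: "inv_norm \<in> ?A" "(\<lambda>C. ln (norm2 C) / 2) \<in> ?A" "b \<in> ?A" "r \<in> ?A" "(\<lambda>C. B k (b C)) \<in> ?A" for k
    by (intro function_algebra.gen; simp add: G_def)+
  have scale: "(\<lambda>x. c * f x) \<in> ?A" if "f \<in> ?A" for f c
    using function_algebra.mult[OF function_algebra.const[of c] that] .
  have minus: "(\<lambda>x. f x - g x) \<in> ?A" if "f \<in> ?A" "g \<in> ?A" for f g
    using function_algebra.add[OF that(1) scale[OF that(2), of "-1"]] by simp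
  have uminus: "(\<lambda>x. - f x) \<in> ?A" if "f \<in> ?A" for f
    using scale[OF that, of "-1"] by simp
  have power: "(\<lambda>x. f x ^ n) \<in> ?A" if "f \<in> ?A" for f n
    by (induction n) (auto intro: function_algebra.mult function_algebra.const that)
  have pairing: "(\<lambda>C. pairing C v) \<in> ?A" for v
    by (intro linear linearI)
       (simp_all add: pairing_def linear_add[OF linear_flat_part] linear_cmul[OF linear_flat_part]
          matrix_vector_right_distrib matrix_vector_mult_scaleR inner_add_left)
  have slope: "slope \<in> ?A"
    unfolding slope_def[abs_def] by (intro function_algebra.mult gens linear linearI) auto
  have slope': "(\<lambda>C. slope' C v) \<in> ?A" for v
    unfolding slope'_def
    by (intro minus scale function_algebra.mult power gens slope pairing)
  have b_deriv: "(b has_derivative (\<lambda>v. r C * slope' C v)) (at C)" if "C \<in> regular" for C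
    using DERIV_of_slope[OF that \<beta>_deriv] that p unfolding b_def[abs_def] r_def by (simp add: regular_def)
  have comp_deriv: "((\<lambda>C. f (b C)) has_derivative (\<lambda>v. f' * (r C * slope' C v))) (at C)"
    if "C \<in> regular" "(f has_real_derivative f') (at (b C))" for C f f'
    using has_derivative_compose[OF b_deriv[OF that(1)] that(2)[unfolded has_field_derivative_def]] by simp
  have "smooth regular f" if "f \<in> ?A" for f
  proof (rule smooth_function_algebra[OF open_regular _ that])
    fix f assume "f \<in> G"
    then consider "linear f" | "f = inv_norm" | "f = (\<lambda>C. ln (norm2 C) / 2)" | "f = b" | "f = r"
      | k where "f = (\<lambda>C. B k (b C))" by (auto simp: G_def)
    thus "\<exists>f'. (\<forall>x\<in>regular. (f has_derivative f' x) (at x)) \<and> (\<forall>v\<in>Basis. (\<lambda>x. f' x v) \<in> ?A)"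
    proof cases
      case 1
      thus ?thesis
        by (intro exI[of _ "\<lambda>_. f"]) (auto intro: linear_imp_has_derivative function_algebra.const)
    next
      case 2
      have "(inv_norm has_derivative (\<lambda>v. - (inv_norm C ^ 3 * pairing C v))) (at C)" if "C \<in> regular" for C
        using inv_norm_has_derivative[of C] that by (simp add: regular_def)
      thus ?thesis unfolding 2
        by (intro exI[of _ "\<lambda>C v. - (inv_norm C ^ 3 * pairing C v)"])
           (auto intro!: function_algebra.mult uminus power gens pairing)
    next
      case 3
      show ?thesis unfolding 3
        by (rule exI[of _ "\<lambda>C v. (inv_norm C)\<^sup>2 * pairing C v"])
           (auto simp: regular_def intro!: ln_norm2_has_derivative function_algebra.mult power gens pairing)
    next
      case 4
      show ?thesis unfolding 4
        by (rule exI[of _ "\<lambda>C v. r C * slope' C v"])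
           (auto intro!: b_deriv function_algebra.mult gens slope')
    next
      case 5
      have "(r has_derivative (\<lambda>v. - (B 2 (b C) * (r C)\<^sup>2 * (r C * slope' C v)))) (at C)" if C: "C \<in> regular" for C
      proof -
        have s: "slope C \<in> I" using C by (simp add: regular_def)
        have "((\<lambda>e. 1 / B 1 e) has_real_derivative - (B 2 (b C) * (1 / B 1 (b C))\<^sup>2)) (at (b C))"
          using B[OF s, of 1] B1[OF s] unfolding b_def
          by (auto intro!: derivative_eq_intros simp: power2_eq_square numeral_2_eq_2 divide_inverse)
        from comp_deriv[OF C this] show ?thesis by (simp add: r_def[abs_def])
      qed
      thus ?thesis unfolding 5
        by (intro exI[of _ "\<lambda>C v. - (B 2 (b C) * (r C)\<^sup>2 * (r C * slope' C v))"])
           (auto intro!: function_algebra.mult uminus power gens slope')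
    next
      case (6 k)
      have "((\<lambda>C. B k (b C)) has_derivative (\<lambda>v. B (k + 1) (b C) * (r C * slope' C v))) (at C)"
        if C: "C \<in> regular" for C
        using comp_deriv[OF C B[of "slope C" k, folded b_def]] C by (simp add: regular_def b_def)
      thus ?thesis unfolding 6
        by (intro exI[of _ "\<lambda>C v. B (k + 1) (b C) * (r C * slope' C v)"])
           (auto intro!: function_algebra.mult gens slope')
    qed
  qed
  moreover have "energy \<in> ?A"
    unfolding energy_def[abs_def] b_def[symmetric]
    by (intro function_algebra.add function_algebra.const gens)
  ultimately show ?thesis by blast
qed

end

section \<open>Flat metrics on the torus\<close>

lemma matrix_inv:
  assumes "invertible A"
  shows "A ** matrix_inv A = mat 1" "matrix_inv A ** A = mat 1"
  using someI_ex[OF assms[unfolded invertible_def]] by (simp_all add: matrix_inv_def)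

lemma matrix_inv_unique_left:
  fixes A :: "real^'n^'n"
  assumes "B ** A = mat 1"
  shows "matrix_inv A = B"
proof -
  have "invertible A" using assms invertible_left_inverse by blast
  hence "B ** (A ** matrix_inv A) = B" by (simp add: matrix_inv)
  thus ?thesis by (simp add: matrix_mul_assoc assms)
qed

lemma matrix_inv_vector:
  fixes A :: "real^'n^'n"
  assumes "invertible A"
  shows "A *v (matrix_inv A *v x) = x" "matrix_inv A *v (A *v x) = x"
  using matrix_inv[OF assms] by (simp_all add: matrix_vector_mul_assoc)

lemma positive_definite_inverse:
  fixes A :: "real^'n^'n"
  assumes sym: "transpose A = A" and pos: "\<And>v. v \<noteq> 0 \<Longrightarrow> 0 < v \<bullet> (A *v v)"
  shows "invertible A" "transpose (matrix_inv A) = matrix_inv A"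
    "\<And>v. v \<noteq> 0 \<Longrightarrow> 0 < v \<bullet> (matrix_inv A *v v)"
proof -
  show inv: "invertible A"
    using pos by (metis inner_zero_right invertible_left_inverse less_irrefl matrix_left_invertible_ker)
  have "matrix_inv A ** A = mat 1" "A ** matrix_inv A = mat 1" using matrix_inv[OF inv] by auto
  hence "transpose (matrix_inv A) ** A = mat 1"
    by (metis matrix_transpose_mul sym transpose_mat)
  thus "transpose (matrix_inv A) = matrix_inv A" by (metis matrix_inv_unique_left)
  fix v :: "real^'n" assume "v \<noteq> 0"
  define y where "y = matrix_inv A *v v"
  have v: "v = A *v y" by (simp add: y_def matrix_inv_vector[OF inv])
  hence "y \<noteq> 0" using \<open>v \<noteq> 0\<close> by auto
  hence "0 < v \<bullet> y" using pos[of y] v by (metis inner_commute)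
  thus "0 < v \<bullet> (matrix_inv A *v v)" unfolding y_def .
qed

lemma conorm2_pos:
  assumes "riemannian_metric g" "p \<noteq> 0"
  shows "0 < conorm2 g q p"
  using assms positive_definite_inverse(3)[of "g q" p] by (simp add: conorm2_def riemannian_metric_def)

text \<open>
  The inverse of the metric matrix at any point is the pull-back of the constant matrix \<open>matrix_inv Q\<close> by the
  map that sends a covector to its flat momentum.
\<close>

lemma flat_coordinates_conorm2:
  assumes g: "riemannian_metric g" and flat: "flat_coordinates g \<phi> Q"
  shows "transpose (matrix_inv Q) = matrix_inv Q"
    and "\<And>v. v \<noteq> 0 \<Longrightarrow> 0 < v \<bullet> (matrix_inv Q *v v)"
    and "conorm2 g (sqrt M *\<^sub>R w) W = flat_momentum \<phi> M w W \<bullet> (matrix_inv Q *v flat_momentum \<phi> M w W)"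
proof -
  have Q: "transpose Q = Q \<and> (\<forall>v. v \<noteq> 0 \<longrightarrow> 0 < v \<bullet> (Q *v v)) \<and>
     conorm2 g q p = (matrix_inv (transpose (jacobian \<phi> (at q))) *v p) \<bullet>
        (matrix_inv Q *v (matrix_inv (transpose (jacobian \<phi> (at q))) *v p))" for q p
  proof -
    define J where "J = jacobian \<phi> (at q)"
    have gq: "g q = transpose J ** Q ** J" using flat by (simp add: flat_coordinates_def J_def)
    have sym: "transpose (g q) = g q" and pos: "\<And>v. v \<noteq> 0 \<Longrightarrow> 0 < v \<bullet> (g q *v v)"
      using g by (auto simp: riemannian_metric_def)
    have "det (g q) \<noteq> 0" using positive_definite_inverse(1)[OF sym pos] by (simp add: invertible_det_nz)
    hence "det J \<noteq> 0" by (simp add: gq det_mul)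
    hence J: "invertible J" "invertible (transpose J)" by (simp_all add: invertible_det_nz)
    have tr: "x \<bullet> (transpose J *v y) = (J *v x) \<bullet> y" for x y
      by (metis dot_lmul_matrix vector_transpose_matrix)
    have g_form: "x \<bullet> (g q *v y) = (J *v x) \<bullet> (Q *v (J *v y))" for x y
      by (simp only: gq tr matrix_vector_mul_assoc[symmetric])
    have Q_pos: "0 < v \<bullet> (Q *v v)" if "v \<noteq> 0" for v
      using pos[of "matrix_inv J *v v"] that unfolding g_form
      by (metis J(1) matrix_inv_vector(1) matrix_vector_mult_0_right)
    have "transpose J ** transpose Q ** J = transpose J ** Q ** J"
      using sym unfolding gq by (simp add: matrix_transpose_mul transpose_transpose matrix_mul_assoc)
    hence "(transpose J ** transpose Q ** J) ** matrix_inv J = (transpose J ** Q ** J) ** matrix_inv J" by simp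
    hence "transpose J ** transpose Q = transpose J ** Q"
      using matrix_inv[OF J(1)] by (simp flip: matrix_mul_assoc)
    hence "matrix_inv (transpose J) ** (transpose J ** transpose Q) = matrix_inv (transpose J) ** (transpose J ** Q)" by simp
    hence Q_sym: "transpose Q = Q"
      using matrix_inv[OF J(2)] by (simp add: matrix_mul_assoc)
    have Q_inv: "invertible Q" using positive_definite_inverse(1)[OF Q_sym] Q_pos by blast
    define P where "P = matrix_inv (transpose J) *v p"
    define y where "y = matrix_inv J *v (matrix_inv Q *v P)"
    have "g q *v y = transpose J *v (Q *v (J *v y))" unfolding gq by (simp flip: matrix_vector_mul_assoc)
    also have "\<dots> = p"
      by (simp only: y_def P_def matrix_inv_vector(1)[OF J(1)] matrix_inv_vector(1)[OF J(2)] matrix_inv_vector(1)[OF Q_inv])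
    finally have "g q *v y = p" .
    hence "matrix_inv (g q) *v p = y"
      using matrix_inv_vector(2)[OF positive_definite_inverse(1)[OF sym pos], of y] by simp
    hence "conorm2 g q p = p \<bullet> y" by (simp add: conorm2_def)
    also have "\<dots> = (transpose J *v P) \<bullet> y" by (simp only: P_def matrix_inv_vector(1)[OF J(2)])
    also have "\<dots> = P \<bullet> (J *v y)" by (metis tr inner_commute)
    also have "\<dots> = P \<bullet> (matrix_inv Q *v P)" by (simp add: y_def matrix_inv_vector J)
    finally show ?thesis using Q_sym Q_pos by (simp add: P_def J_def)
  qed
  thus "transpose (matrix_inv Q) = matrix_inv Q" "\<And>v. v \<noteq> 0 \<Longrightarrow> 0 < v \<bullet> (matrix_inv Q *v v)"
    using positive_definite_inverse[of Q] by blast+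
  show "conorm2 g (sqrt M *\<^sub>R w) W = flat_momentum \<phi> M w W \<bullet> (matrix_inv Q *v flat_momentum \<phi> M w W)"
    using Q by (simp add: flat_momentum_def)
qed

lemma continuous_on_det:
  fixes A :: "'a::topological_space \<Rightarrow> real^'n^'n"
  assumes "\<And>i j. continuous_on S (\<lambda>x. A x $ i $ j)"
  shows "continuous_on S (\<lambda>x. det (A x))"
  unfolding det_def by (intro continuous_intros assms)

text \<open>
  The inverse matrix depends continuously on the matrix by Cramer's rule.
\<close>

lemma continuous_on_conorm2:
  fixes g :: "real^'n \<Rightarrow> real^'n^'n"
  assumes "riemannian_metric g" "continuous_on S q" "continuous_on S p"
  shows "continuous_on S (\<lambda>x. conorm2 g (q x) (p x))"
proof -
  have g_cont: "continuous_on UNIV g"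
    using assms(1) by (auto simp: riemannian_metric_def smooth_def dest: spec[of _ 0])
  have "invertible (g x)" for x
    using assms(1) positive_definite_inverse(1)[of "g x"] by (simp add: riemannian_metric_def)
  hence det: "det (g x) \<noteq> 0" for x by (simp add: invertible_det_nz)
  have entry: "continuous_on S (\<lambda>x. g (q x) $ i $ j)" for i j
    by (intro continuous_intros continuous_on_compose2[OF g_cont assms(2)]) auto
  have "matrix_inv (g x) *v v = (\<chi> k. det (\<chi> i j. if j = k then v $ i else g x $ i $ j) / det (g x))" for x v
    using cramer[OF det, of x "matrix_inv (g x) *v v" v] matrix_inv_vector(1)[of "g x" v] det
    by (simp add: invertible_det_nz)
  hence "conorm2 g (q x) (p x) =
      (\<Sum>k\<in>UNIV. p x $ k * (det (\<chi> i j. if j = k then p x $ i else g (q x) $ i $ j) / det (g (q x))))" for x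
    by (simp add: conorm2_def inner_vec_def)
  moreover have "continuous_on S (\<lambda>x. if j = k then p x $ i else g (q x) $ i $ j)" for i j k
    by (cases "j = k") (auto intro: entry continuous_intros assms(3))
  hence "continuous_on S (\<lambda>x. \<Sum>k\<in>UNIV. p x $ k *
      (det (\<chi> i j. if j = k then p x $ i else g (q x) $ i $ j) / det (g (q x))))"
    by (intro continuous_on_sum continuous_on_mult continuous_on_divide continuous_on_det
        continuous_on_component[OF assms(3)]) (simp_all add: entry det)
  ultimately show ?thesis by simp
qed

section \<open>Thermostatic equilibria\<close>

theorem theorem1p2:
  fixes g :: "real^'n \<Rightarrow> real^'n^'n" and V :: "real^'n \<Rightarrow> real" and M r :: real
  assumes "flat_metric g"
    and "torus_periodic V" and "C_real r UNIV V" and "r > 2 * real CARD('n) + 2"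
    and "M > 0"
  shows "(\<forall>x\<in>phase_space.
            ((\<lambda>T. nose_rescaled g V M (1 / T) x) \<longlongrightarrow> nose_limit g M x) at_top) \<and>
         (\<exists>U. open U \<and> torus_invariant M U \<and>
            thermostatic_equilibria (nose_limit g M) \<subseteq> U \<and> U \<subseteq> phase_space \<and>
            (\<forall>\<phi> Q. flat_coordinates g \<phi> Q \<longrightarrow>
               nondegenerate_on kolmogorov_nondegenerate_at (nose_limit g M)
                 nonzero_momentum (actions (nose_limit g M) \<phi> M) U \<and>
               nondegenerate_on isoenergetically_nondegenerate_at (nose_limit g M)
                 nonzero_momentum (actions (nose_limit g M) \<phi> M) U))"
proof
  show "\<forall>x\<in>phase_space. ((\<lambda>T. nose_rescaled g V M (1 / T) x) \<longlongrightarrow> nose_limit g M x) at_top"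
  proof
    fix x :: "'n phase"
    obtain \<sigma> w S W where x: "x = (\<sigma>, w, S, W)" by (cases x)
    have "((\<lambda>T. 1 / T * V (sqrt M *\<^sub>R w)) \<longlongrightarrow> 0 * V (sqrt M *\<^sub>R w)) at_top"
      by (intro tendsto_mult tendsto_const tendsto_divide_0[OF tendsto_const])
         (simp add: filterlim_at_top_imp_at_infinity filterlim_ident)
    hence "((\<lambda>T. nose_limit g M x + 1 / T * V (sqrt M *\<^sub>R w)) \<longlongrightarrow> nose_limit g M x + 0 * V (sqrt M *\<^sub>R w)) at_top"
      by (intro tendsto_add tendsto_const)
    moreover have "nose_rescaled g V M (1 / T) x = nose_limit g M x + 1 / T * V (sqrt M *\<^sub>R w)" for T
      by (simp add: x nose_rescaled_def nose_limit_def)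
    ultimately show "((\<lambda>T. nose_rescaled g V M (1 / T) x) \<longlongrightarrow> nose_limit g M x) at_top" by simp
  qed
next
  have riem: "riemannian_metric g" using assms(1) by (simp add: flat_metric_def)
  obtain B :: "nat \<Rightarrow> real \<Rightarrow> real" and \<beta> l u \<epsilon> where "0 < \<epsilon>"
    and \<beta>: "\<And>t. t \<in> {l<..<u} \<Longrightarrow> (\<beta> has_real_derivative 1 / B 1 (\<beta> t)) (at t)"
    and B: "\<And>t k. t \<in> {l<..<u} \<Longrightarrow> (B k has_real_derivative B (k + 1) (\<beta> t)) (at (\<beta> t))"
    and B\<beta>: "\<And>t. t \<in> {l<..<u} \<Longrightarrow> B 0 (\<beta> t) = t"
    and B1: "\<And>t. t \<in> {l<..<u} \<Longrightarrow> 0 < B 1 (\<beta> t)"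
    and B01: "\<And>t. t \<in> {l<..<u} \<Longrightarrow> B 0 (\<beta> t) \<noteq> B 1 (\<beta> t)"
    and B12: "\<And>t. t \<in> {l<..<u} \<Longrightarrow> B 1 (\<beta> t) \<noteq> B 2 (\<beta> t)"
    and small: "\<And>\<rho>. 0 \<le> \<rho> \<Longrightarrow> \<rho>\<^sup>2 / 2 < \<epsilon> \<Longrightarrow> unit_action \<rho> \<in> {l<..<u}"
    and inverse: "\<And>\<rho>. 0 \<le> \<rho> \<Longrightarrow> unit_action \<rho> \<in> {l<..<u} \<Longrightarrow> \<beta> (unit_action \<rho>) = \<rho>\<^sup>2 / 2"
    by (rule unit_action_inverse) (rule that; assumption)
  define F :: "'n phase \<Rightarrow> real" where "F = nose_limit g M"
  define a :: "'n phase \<Rightarrow> real" where "a = (\<lambda>(\<sigma>, w, S, W). conorm2 g (sqrt M *\<^sub>R w) W)"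
  define e where "e x = F x - 1 / 2 - ln (a x) / 2" for x
  have a_pos: "0 < a x" if "x \<in> nonzero_momentum" for x
    using that conorm2_pos[OF riem] by (auto simp: nonzero_momentum_def a_def)
  have "open (nonzero_momentum :: 'n phase set)"
  proof -
    have eq: "nonzero_momentum = {x :: 'n phase. 0 < fst x} \<inter> {x. snd (snd (snd x)) \<noteq> 0}"
      by (auto simp: nonzero_momentum_def phase_space_def)
    show ?thesis
      unfolding eq by (intro open_Int open_Collect_less open_Collect_neq continuous_intros)
  qed
  have e_cont: "continuous_on nonzero_momentum e"
  proof -
    let ?w = "\<lambda>x :: 'n phase. sqrt M *\<^sub>R fst (snd x)" and ?W = "\<lambda>x :: 'n phase. snd (snd (snd x))"
    have a_eq: "a = (\<lambda>x. conorm2 g (?w x) (?W x))" by (auto simp: a_def fun_eq_iff)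
    have F_eq: "F = (\<lambda>x. conorm2 g (?w x) (?W x /\<^sub>R fst x) / 2 + (fst (snd (snd x)))\<^sup>2 / 2 + ln (fst x))"
      by (auto simp: F_def nose_limit_def fun_eq_iff)
    have pos: "0 < fst x" if "x \<in> nonzero_momentum" for x :: "'n phase"
      using that by (auto simp: nonzero_momentum_def phase_space_def)
    have "continuous_on nonzero_momentum a"
      unfolding a_eq by (intro continuous_on_conorm2[OF riem] continuous_intros)
    moreover have "continuous_on nonzero_momentum F"
      unfolding F_eq using pos
      by (intro continuous_on_conorm2[OF riem] continuous_intros) force+
    ultimately show ?thesis
      unfolding e_def using a_pos by (intro continuous_intros) force+
  qed
  \<comment> \<open>The energy above the minimum on the given momentum, \<open>e\<close>, vanishes exactly at the equilibria.\<close>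
  define U where "U = nonzero_momentum \<inter> {x. e x < \<epsilon>}"
  have "open (e -` {..<\<epsilon>} \<inter> nonzero_momentum)"
    using e_cont \<open>open nonzero_momentum\<close> by (simp add: continuous_on_open_vimage)
  hence "open U" by (simp add: U_def vimage_def Int_def conj_commute)
  have "torus_invariant M U"
  proof -
    have "(\<sigma>, w + k /\<^sub>R sqrt M, S, W) \<in> U" if x: "(\<sigma>, w, S, W) \<in> U" and k: "k \<in> int_lattice"
      for \<sigma> w S W k
    proof -
      have "sqrt M *\<^sub>R (w + k /\<^sub>R sqrt M) = sqrt M *\<^sub>R w + k"
        using \<open>M > 0\<close> by (simp add: scaleR_add_right)
      hence "g (sqrt M *\<^sub>R (w + k /\<^sub>R sqrt M)) = g (sqrt M *\<^sub>R w)"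
        using riem k by (simp add: riemannian_metric_def torus_periodic_def)
      hence "conorm2 g (sqrt M *\<^sub>R (w + k /\<^sub>R sqrt M)) p = conorm2 g (sqrt M *\<^sub>R w) p" for p
        by (simp add: conorm2_def)
      thus ?thesis using x
        by (simp add: U_def e_def F_def a_def nose_limit_def nonzero_momentum_def phase_space_def)
    qed
    thus ?thesis by (auto simp: torus_invariant_def)
  qed
  have equilibria: "thermostatic_equilibria F \<subseteq> U"
  proof
    fix x :: "'n phase" assume "x \<in> thermostatic_equilibria F"
    then obtain \<sigma> w W where x: "x = (\<sigma>, w, 0, W)" "0 < \<sigma>" "conorm2 g (sqrt M *\<^sub>R w) W = \<sigma>\<^sup>2"
      by (auto simp: F_def thermostatic_equilibria_nose_limit)
    have "W \<noteq> 0" using x(2,3) by (auto simp: conorm2_def)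
    moreover have "F x = 1 / 2 + ln \<sigma>"
      using x(2,3) by (simp add: F_def x(1) nose_limit_def conorm2_scaleR power_inverse)
    moreover have "ln (a x) = 2 * ln \<sigma>" using x by (simp add: a_def ln_realpow)
    ultimately show "x \<in> U"
      using x(1,2) \<open>0 < \<epsilon>\<close> by (simp add: U_def e_def nonzero_momentum_def phase_space_def)
  qed
  have nondeg: "nondegenerate_on kolmogorov_nondegenerate_at F nonzero_momentum (actions F \<phi> M) U \<and>
      nondegenerate_on isoenergetically_nondegenerate_at F nonzero_momentum (actions F \<phi> M) U"
    if flat: "flat_coordinates g \<phi> Q" for \<phi> Q
  proof -
    note K = flat_coordinates_conorm2[OF riem flat]
    interpret flat_energy "matrix_inv Q" \<beta> "\<lambda>t. 1 / B 1 (\<beta> t)" "\<lambda>t. - B 2 (\<beta> t) / B 1 (\<beta> t) ^ 3" "{l<..<u}"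
    proof
      fix t assume t: "t \<in> {l<..<u}"
      note B1 = B1[OF t]
      show "(\<beta> has_real_derivative 1 / B 1 (\<beta> t)) (at t)" using \<beta>[OF t] .
      have "((\<lambda>t. B 1 (\<beta> t)) has_real_derivative B 2 (\<beta> t) * (1 / B 1 (\<beta> t))) (at t)"
        using DERIV_chain2[OF B[OF t, of 1] \<beta>[OF t]] by (simp only: one_add_one)
      thus "((\<lambda>t. 1 / B 1 (\<beta> t)) has_real_derivative - B 2 (\<beta> t) / B 1 (\<beta> t) ^ 3) (at t)"
        using B1 by (auto intro!: derivative_eq_intros simp: power3_eq_cube divide_inverse)
      show "t * (1 / B 1 (\<beta> t)) \<noteq> 1" using B\<beta>[OF t] B01[OF t] B1 by auto
      show "- B 2 (\<beta> t) / B 1 (\<beta> t) ^ 3 + (1 / B 1 (\<beta> t))\<^sup>2 \<noteq> 0"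
        using B12[OF t] B1 by (simp add: power2_eq_square power3_eq_cube field_simps)
    qed (use K in auto)
    have smooth: "smooth regular energy"
      by (rule smooth_energy[of B]) (use B B1 in \<open>auto simp: less_imp_neq[THEN not_sym]\<close>)
    have at_point: "flat_part (actions F \<phi> M x) \<noteq> 0 \<and> slope (actions F \<phi> M x) = unit_action (sqrt (2 * e x))
        \<and> norm2 (actions F \<phi> M x) = a x \<and> 0 \<le> e x"
      if x: "x \<in> nonzero_momentum" for x
    proof -
      obtain \<sigma> w S W where xe: "x = (\<sigma>, w, S, W)" by (cases x)
      have pos: "0 < \<sigma>" using x by (simp add: xe nonzero_momentum_def phase_space_def)
      define P where "P = flat_momentum \<phi> M w W"
      have act: "actions F \<phi> M x = action_vector (action F x) P"
        by (simp add: actions_def xe action_vector_def P_def)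
      have "norm2 (actions F \<phi> M x) = P \<bullet> (matrix_inv Q *v P)"
        by (simp add: act norm2_def)
      also have "\<dots> = a x" by (simp add: K(3) P_def a_def xe)
      finally have n: "norm2 (actions F \<phi> M x) = a x" .
      have ap: "0 < a x" using a_pos[OF x] .
      hence "P \<noteq> 0" using n by (auto simp: act norm2_def)
      have "action F x = sqrt (a x) * unit_action (sqrt (2 * e x))"
        using action_nose_limit[of g M w W \<sigma> S] ap pos by (simp add: a_def e_def F_def xe)
      hence "slope (actions F \<phi> M x) = unit_action (sqrt (2 * e x))"
        using ap n by (simp add: slope_def inv_norm_def act)
      moreover have "0 \<le> e x"
        using level_curve_nose_limit(1)[of g M w W \<sigma> S] ap pos by (simp add: a_def e_def F_def xe)
      ultimately show ?thesis using n \<open>P \<noteq> 0\<close> by (simp add: act)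
    qed
    have foa: "function_of_actions F nonzero_momentum (actions F \<phi> M) energy regular"
      unfolding function_of_actions_def
    proof (intro conjI ballI impI open_regular smooth)
      fix x :: "'n phase" assume x: "x \<in> nonzero_momentum" "actions F \<phi> M x \<in> regular"
      note pt = at_point[OF x(1)]
      \<comment> \<open>The energy of \<open>x\<close> may be arbitrarily large here; only \<open>A/|W|\<close> is known to be small.\<close>
      have "\<beta> (unit_action (sqrt (2 * e x))) = (sqrt (2 * e x))\<^sup>2 / 2"
        using x(2) pt by (intro inverse) (auto simp: regular_def)
      hence "\<beta> (slope (actions F \<phi> M x)) = e x" using pt by simp
      thus "F x = energy (actions F \<phi> M x)" using pt by (simp add: energy_def e_def)
    qed
    have "actions F \<phi> M x \<in> regular" if "x \<in> U" for x
    proof -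
      have x: "x \<in> nonzero_momentum" "e x < \<epsilon>" using that by (auto simp: U_def)
      have "unit_action (sqrt (2 * e x)) \<in> {l<..<u}"
        using x(2) at_point[OF x(1)] by (intro small) auto
      thus ?thesis using at_point[OF x(1)] by (simp add: regular_def)
    qed
    moreover have "U \<subseteq> nonzero_momentum" by (simp add: U_def)
    ultimately show ?thesis
      unfolding nondegenerate_on_def using foa energy_kolmogorov energy_isoenergetic by blast
  qed
  have "U \<subseteq> phase_space" by (auto simp: U_def nonzero_momentum_def)
  thus "\<exists>U. open U \<and> torus_invariant M U \<and>
            thermostatic_equilibria (nose_limit g M) \<subseteq> U \<and> U \<subseteq> phase_space \<and>
            (\<forall>\<phi> Q. flat_coordinates g \<phi> Q \<longrightarrow>
               nondegenerate_on kolmogorov_nondegenerate_at (nose_limit g M)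
                 nonzero_momentum (actions (nose_limit g M) \<phi> M) U \<and>
               nondegenerate_on isoenergetically_nondegenerate_at (nose_limit g M)
                 nonzero_momentum (actions (nose_limit g M) \<phi> M) U)"
    using \<open>open U\<close> \<open>torus_invariant M U\<close> equilibria nondeg unfolding F_def by blast
qed

end
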